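(* Assume model $\mathcal M_{\mathrm s}$ and let $\alpha\in(0,1]$. Then the proposed procedure $\mathbb T^*$ is uniformly optimal in $\mathcal T_\alpha$: $\mathbb T^*\in\mathcal T_\alpha$ and for every $t=1,2,\dots$, $$\mathbb E\big(\mathrm U_t(\mathbb T^* )\big)=\sup_{\mathbb T\in\mathcal T_\alpha}\mathbb E\big(\mathrm U_t(\mathbb T)\big).$$
   Context: There are $K\ge1$ data streams. Each stream $k$ has a change point $\tau_k\in\{0,1,2,\dots\}\cup\{\infty\}$. Observations $X_{k,t}$ ($1\le k\le K$, $t=1,2,\dots$) are, conditionally on $(\tau_1,\dots,\tau_K)$, independent over $k$ and $t$, with $X_{k,t}$ having density $p_{k,t}$ if $t\le\tau_k$ and $q_{k,t}$ if $t>\tau_k$ with respect to a baseline measure $\mu$. Model $\mathcal M_{\mathrm s}$: $\tau_1,\dots,\tau_K$ are i.i.d. with $\mathbb P(\tau_k=m)=\theta(1-\theta)^m$, $m=0,1,2,\dots$, for some $\theta\in(0,1)$, and $p_{k,t}=p$, $q_{k,t}=q$ for all $k,t$. A compound sequential detection procedure consists of index sets $S_1=\{1,\dots,K\}\supseteq S_2\supseteq\cdots$ and a filtration defined inductively by $\mathcal F_1=\sigma(X_{k,1}:1\le k\le K)$ and $\mathcal F_t=\sigma(\mathcal F_{t-1},S_t,X_{k,t}:k\in S_t)$ for $t>1$, where $S_t$ is required to be $\mathcal F_{t-1}$-measurable; equivalently $\mathbb T=(T_1,\dots,T_K)$ with $T_k=\sup\{t:k\in S_t\}$. $\mathcal T$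 is the set of all such procedures. For $t\ge1$, $\mathrm{FNP}_{t+1}(\mathbb T)=\sum_{k\in S_{t+1}}\mathbf 1(\tau_k<t)/(|S_{t+1}|\vee1)$, $\mathrm{LFNR}_{t+1}(\mathbb T)=\mathbb E(\mathrm{FNP}_{t+1}(\mathbb T)\mid\mathcal F_t)$, $\mathrm{LFNR}_1(\mathbb T)=0$. $\mathcal T_\alpha=\{\mathbb T\in\mathcal T:\mathrm{LFNR}_t(\mathbb T)\le\alpha\text{ a.s. for all }t\ge1\}$. Stream utilization: $\mathrm U_t(\mathbb T)=\sum_{s=1}^t|S_s|$. Posterior probabilities: $W_{k,t}=\mathbb P(\tau_k<t\mid\mathcal F_t)$. One-step update rule: given $\alpha$, $S_t$ and $(W_{k,t})_{k\in S_t}$, write $S_t=\{k_1,\dots,k_m\}$ ordered so that $W_{k_1,t}\le\cdots\le W_{k_m,t}$, ties broken so that $k_i<k_{i+1}$ when $W_{k_i,t}=W_{k_{i+1},t}$; set $R_0=0$ and $R_n=\frac1n\sum_{i=1}^nW_{k_i,t}$; let $n$ be the largest element of $\{0,\dots,m\}$ with $R_n\le\alpha$; output $S_{t+1}=\{k_1,\dots,k_n\}$ ($\emptyset$ if $n=0$). The proposed procedure $\mathbb T^*$: $S_1=\{1,\dots,K\}$ and, for every $t\ge1$, $S_{t+1}$ is the output of the one-step update rule applied to $\alpha$, $S_t$ and $(W_{k,t})_{k\in S_t}$. *)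

theory Defs
  imports "HOL-Probability.Probability"
begin

text \<open>Streams are indexed by 1..K, time by 1,2,...  A (random) index-set sequence
  S :: nat => 'w => nat set gives S_t(omega) for t >= 1 (S 0 is unused).\<close>

definition obs_filt ::
  "'w measure \<Rightarrow> 'x measure \<Rightarrow> (nat \<Rightarrow> nat \<Rightarrow> 'w \<Rightarrow> 'x) \<Rightarrow> (nat \<Rightarrow> 'w \<Rightarrow> nat set) \<Rightarrow> nat \<Rightarrow> 'w measure"
  where
  "obs_filt M N X S t = sigma (space M)
     ({{\<omega> \<in> space M. S s \<omega> = A} | s A. 1 \<le> s \<and> s \<le> t} \<union>
      {{\<omega> \<in> space M. k \<in> S s \<omega> \<and> X k s \<omega> \<in> B} | s k B. 1 \<le> s \<and> s \<le> t \<and> B \<in> sets N})"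

definition is_procedure ::
  "'w measure \<Rightarrow> 'x measure \<Rightarrow> nat \<Rightarrow> (nat \<Rightarrow> nat \<Rightarrow> 'w \<Rightarrow> 'x) \<Rightarrow> (nat \<Rightarrow> 'w \<Rightarrow> nat set) \<Rightarrow> bool"
  where
  "is_procedure M N K X S \<longleftrightarrow>
     (\<forall>\<omega>\<in>space M. S 1 \<omega> = {1..K}) \<and>
     (\<forall>t\<ge>1. \<forall>\<omega>\<in>space M. S (Suc t) \<omega> \<subseteq> S t \<omega>) \<and>
     (\<forall>t\<ge>1. S (Suc t) \<in> measurable (obs_filt M N X S t) (count_space UNIV))"

definition FNP_next :: "(nat \<Rightarrow> 'w \<Rightarrow> nat) \<Rightarrow> (nat \<Rightarrow> 'w \<Rightarrow> nat set) \<Rightarrow> nat \<Rightarrow> 'w \<Rightarrow> real"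
  where
  "FNP_next \<tau> S t \<omega> =
     (\<Sum>k\<in>S (Suc t) \<omega>. if \<tau> k \<omega> < t then 1 else 0) / real (max (card (S (Suc t) \<omega>)) 1)"

definition LFNR_next ::
  "'w measure \<Rightarrow> 'x measure \<Rightarrow> (nat \<Rightarrow> nat \<Rightarrow> 'w \<Rightarrow> 'x) \<Rightarrow> (nat \<Rightarrow> 'w \<Rightarrow> nat) \<Rightarrow> (nat \<Rightarrow> 'w \<Rightarrow> nat set) \<Rightarrow> nat \<Rightarrow> 'w \<Rightarrow> real"
  where
  "LFNR_next M N X \<tau> S t = real_cond_exp M (obs_filt M N X S t) (FNP_next \<tau> S t)"

text \<open>The class T_alpha (LFNR_1 = 0 <= alpha holds trivially).\<close>
definition T_alpha ::
  "'w measure \<Rightarrow> 'x measure \<Rightarrow> nat \<Rightarrow> (nat \<Rightarrow> nat \<Rightarrow> 'w \<Rightarrow> 'x) \<Rightarrow> (nat \<Rightarrow> 'w \<Rightarrow> nat) \<Rightarrow> real \<Rightarrow> (nat \<Rightarrow> 'w \<Rightarrow> nat set) set"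
  where
  "T_alpha M N K X \<tau> \<alpha> = {S. is_procedure M N K X S \<and>
      0 \<le> \<alpha> \<and> (\<forall>t\<ge>1. AE \<omega> in M. LFNR_next M N X \<tau> S t \<omega> \<le> \<alpha>)}"

definition U :: "(nat \<Rightarrow> 'w \<Rightarrow> nat set) \<Rightarrow> nat \<Rightarrow> 'w \<Rightarrow> real"
  where "U S t \<omega> = (\<Sum>s=1..t. real (card (S s \<omega>)))"

definition posterior ::
  "'w measure \<Rightarrow> 'x measure \<Rightarrow> (nat \<Rightarrow> nat \<Rightarrow> 'w \<Rightarrow> 'x) \<Rightarrow> (nat \<Rightarrow> 'w \<Rightarrow> nat) \<Rightarrow> (nat \<Rightarrow> 'w \<Rightarrow> nat set) \<Rightarrow> nat \<Rightarrow> nat \<Rightarrow> 'w \<Rightarrow> real"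
  where
  "posterior M N X \<tau> S t k =
     real_cond_exp M (obs_filt M N X S t) (indicator {\<omega> \<in> space M. \<tau> k \<omega> < t})"

text \<open>One-step update rule.  The ordering k_1, ..., k_m of S (increasing W, ties broken by
  increasing index) is encoded by ranks: k_i is the element of S of rank i - 1, where the rank
  of k is the number of j in S preceding k in that order.  R n is the average of the n smallest
  (in that order) W values, R 0 = 0; the output is {k_1, ..., k_n} for the largest admissible n.\<close>
definition upd_rank :: "nat set \<Rightarrow> (nat \<Rightarrow> real) \<Rightarrow> nat \<Rightarrow> nat"
  where "upd_rank S W k = card {j \<in> S. W j < W k \<or> (W j = W k \<and> j < k)}"

definition upd_R :: "nat set \<Rightarrow> (nat \<Rightarrow> real) \<Rightarrow> nat \<Rightarrow> real"
  where "upd_R S W n = (if n = 0 then 0 else (\<Sum>k\<in>{k \<in> S. upd_rank S W k < n}. W k) / real n)"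

definition update_rule :: "real \<Rightarrow> nat set \<Rightarrow> (nat \<Rightarrow> real) \<Rightarrow> nat set"
  where
  "update_rule \<alpha> S W =
     (let n = Max {n. n \<le> card S \<and> upd_R S W n \<le> \<alpha>}
      in {k \<in> S. upd_rank S W k < n})"

definition is_Tstar ::
  "'w measure \<Rightarrow> 'x measure \<Rightarrow> nat \<Rightarrow> (nat \<Rightarrow> nat \<Rightarrow> 'w \<Rightarrow> 'x) \<Rightarrow> (nat \<Rightarrow> 'w \<Rightarrow> nat) \<Rightarrow> real \<Rightarrow> (nat \<Rightarrow> 'w \<Rightarrow> nat set) \<Rightarrow> bool"
  where
  "is_Tstar M N K X \<tau> \<alpha> S \<longleftrightarrow>
     (\<forall>\<omega>\<in>space M. S 1 \<omega> = {1..K}) \<and>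
     (\<forall>t\<ge>1. \<forall>\<omega>\<in>space M.
        S (Suc t) \<omega> = update_rule \<alpha> (S t \<omega>) (\<lambda>k. posterior M N X \<tau> S t k \<omega>))"

end

theory Submission
  imports Defs
begin

text \<open>
  Along each stream the posterior probability of a past change, given all observations of that stream, is a Markov
  chain whose transition kernel \<open>kern\<close> is the same for all streams and stochastically increasing. A set of active
  streams with posteriors \<open>u\<close> dominates another one with posteriors \<open>v\<close> if the latter injects into the former without
  increasing the posteriors. Among the selections with \<open>LFNR \<le> \<alpha>\<close>, the one made by the update rule dominates all
  others, and the update rule preserves domination. Hence, by backward induction on the horizon, the expected future
  utilization of the greedy procedure is monotone with respect to domination, and no admissible procedure exceeds it.
\<close>

section \<open>The one-step update rule and domination\<close>

text \<open>No pathwise comparison is available: a competing procedure may keep streams that the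
  greedy one drops, so the two observe different data and their filtrations need not be nested. Two
  devices remove this obstacle. All procedures are measured by the same \<open>V k t\<close>, a
  posterior computed from the full record of stream \<open>k\<close> by a recursion that does not
  mention the procedure; it agrees with \<open>posterior\<close> almost surely wherever the stream
  is active. The competitor is then compared with the number \<open>gval\<close>, a function of the
  current set and its posteriors alone, and not with the sets chosen by the greedy procedure.
  Identical kernels make the labels of streams immaterial, so that an injection may serve where
  inclusion fails. Monotonicity of the kernel needs an argument because a larger posterior changes
  both the update map and the law of the next observation, which is tilted from \<open>p\<close>
  towards \<open>q\<close>. Values are kept in \<open>ennreal\<close>, which postpones integrability
  to the end, where the bound \<open>t * K\<close> supplies finiteness.\<close>

lemma upd_rank_less:
  assumes "finite A" "j \<in> A" "W j < W k \<or> (W j = W k \<and> j < k)"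
  shows "upd_rank A W j < upd_rank A W k"
  unfolding upd_rank_def
proof (rule psubset_card_mono)
  show "{i \<in> A. W i < W j \<or> W i = W j \<and> i < j} \<subset> {i \<in> A. W i < W k \<or> W i = W k \<and> i < k}"
    using assms by fastforce
qed (use assms in simp)

text \<open>Ties in \<open>W\<close> are broken by the index, so of two distinct elements one
  precedes the other and their ranks differ; an injection of \<open>A\<close> into
  \<open>card A\<close> values is onto. Hence the encoding by ranks does list \<open>A\<close> in
  the intended order.\<close>

lemma upd_rank_bij_betw:
  assumes "finite A"
  shows "bij_betw (upd_rank A W) A {..<card A}"
proof -
  have inj: "inj_on (upd_rank A W) A"
  proof (rule inj_onI)
    fix j k assume "j \<in> A" "k \<in> A" "upd_rank A W j = upd_rank A W k"
    then show "j = k"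
      using upd_rank_less[OF assms, of j W k] upd_rank_less[OF assms, of k W j]
      by (metis less_irrefl linorder_neqE_linordered_idom linorder_neqE_nat)
  qed
  have "upd_rank A W k < card A" if "k \<in> A" for k
    unfolding upd_rank_def using that assms by (intro psubset_card_mono) auto
  then have "upd_rank A W ` A \<subseteq> {..<card A}" by auto
  then have "upd_rank A W ` A = {..<card A}"
    using inj by (intro card_subset_eq) (auto simp: card_image)
  with inj show ?thesis by (simp add: bij_betw_def)
qed

lemma card_upd_rank_less:
  assumes "finite A" "n \<le> card A"
  shows "card {k \<in> A. upd_rank A W k < n} = n"
proof -
  note bij = upd_rank_bij_betw[OF assms(1), of W]
  have "upd_rank A W ` {k \<in> A. upd_rank A W k < n} = {..<n}"
  proof
    show "{..<n} \<subseteq> upd_rank A W ` {k \<in> A. upd_rank A W k < n}"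
    proof
      fix i assume i: "i \<in> {..<n}"
      then have "i \<in> upd_rank A W ` A" using bij assms(2) by (auto simp: bij_betw_def)
      with i show "i \<in> upd_rank A W ` {k \<in> A. upd_rank A W k < n}" by auto
    qed
  qed auto
  moreover have "inj_on (upd_rank A W) {k \<in> A. upd_rank A W k < n}"
    using bij by (auto simp: bij_betw_def intro: inj_on_subset)
  ultimately show ?thesis by (metis card_image card_lessThan)
qed

lemma upd_rank_le_imp_le:
  assumes "finite A" "j \<in> A" "upd_rank A W k \<le> upd_rank A W j"
  shows "W k \<le> W j"
  using upd_rank_less[OF assms(1,2), of W k] assms(3) by force

section \<open>Domination between sets of streams\<close>

definition dominates :: "nat set \<Rightarrow> (nat \<Rightarrow> real) \<Rightarrow> nat set \<Rightarrow> (nat \<Rightarrow> real) \<Rightarrow> bool" where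
  "dominates A u B v \<longleftrightarrow> (\<exists>\<sigma>. inj_on \<sigma> B \<and> \<sigma> ` B \<subseteq> A \<and> (\<forall>b\<in>B. u (\<sigma> b) \<le> v b))"

lemma dominates_trans:
  assumes "dominates A u B v" "dominates B v C w"
  shows "dominates A u C w"
proof -
  obtain \<sigma> where \<sigma>: "inj_on \<sigma> B" "\<sigma> ` B \<subseteq> A" "\<And>b. b \<in> B \<Longrightarrow> u (\<sigma> b) \<le> v b"
    using assms(1) unfolding dominates_def by blast
  obtain \<rho> where \<rho>: "inj_on \<rho> C" "\<rho> ` C \<subseteq> B" "\<And>c. c \<in> C \<Longrightarrow> v (\<rho> c) \<le> w c"
    using assms(2) unfolding dominates_def by blast
  have "inj_on (\<sigma> \<circ> \<rho>) C" using \<sigma> \<rho> by (meson comp_inj_on inj_on_subset)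
  moreover have "(\<sigma> \<circ> \<rho>) ` C \<subseteq> A" using \<sigma>(2) \<rho>(2) by fastforce
  moreover have "u ((\<sigma> \<circ> \<rho>) c) \<le> w c" if "c \<in> C" for c
    using \<sigma>(3)[of "\<rho> c"] \<rho>(2) \<rho>(3)[OF that] that by force
  ultimately show ?thesis unfolding dominates_def by blast
qed

lemma dominates_subset:
  assumes "B \<subseteq> A" "\<And>b. b \<in> B \<Longrightarrow> u b \<le> v b"
  shows "dominates A u B v"
  unfolding dominates_def using assms by (intro exI[of _ id]) auto

lemma dominates_sum_le:
  assumes "inj_on \<sigma> B" "\<And>b. b \<in> B \<Longrightarrow> u (\<sigma> b) \<le> v b"
  shows "sum u (\<sigma> ` B) \<le> (sum v B :: real)"
  using assms by (simp add: sum.reindex sum_mono)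

lemma lowest_dominates:
  assumes "finite A" "C \<subseteq> A" "card C \<le> n" "n \<le> card A"
  shows "dominates {k \<in> A. upd_rank A w k < n} w C w"
proof -
  define D where "D = {k \<in> A. upd_rank A w k < n}"
  have fin: "finite C" "finite D" using assms finite_subset by (auto simp: D_def)
  have "card C \<le> card D" using assms card_upd_rank_less by (simp add: D_def)
  then have "card (C - D) \<le> card (D - C)"
    using fin by (simp add: card_Diff_subset_Int Int_commute)
  then obtain g where g: "g ` (C - D) \<subseteq> D - C" "inj_on g (C - D)"
    using card_le_inj[of "C - D" "D - C"] fin by auto
  have le: "w d \<le> w c" if "d \<in> D" "c \<in> A - D" for c d
    using that by (intro upd_rank_le_imp_le[OF assms(1)]) (auto simp: D_def)
  define \<sigma> where "\<sigma> c = (if c \<in> D then c else g c)" for c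
  have "inj_on \<sigma> C" using g by (auto simp: inj_on_def \<sigma>_def)
  moreover have "\<sigma> ` C \<subseteq> D" using g by (auto simp: \<sigma>_def)
  moreover have "w (\<sigma> c) \<le> w c" if "c \<in> C" for c
    using that le g assms(2) by (auto simp: \<sigma>_def)
  ultimately show ?thesis unfolding dominates_def D_def by blast
qed

section \<open>Feasible selections and the optimality of the rule in one step\<close>

text \<open>The bound on the average posterior is multiplied out, so that the empty selection needs
  no convention for division by zero.\<close>

definition feasible :: "real \<Rightarrow> nat set \<Rightarrow> (nat \<Rightarrow> real) \<Rightarrow> bool" where
  "feasible \<alpha> C w \<longleftrightarrow> sum w C \<le> \<alpha> * real (card C)"

lemma update_rule_lowest:
  assumes "finite A" "0 \<le> \<alpha>"
  obtains n where "n \<le> card A" "upd_R A w n \<le> \<alpha>" "update_rule \<alpha> A w = {k \<in> A. upd_rank A w k < n}"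
    "\<And>m. m \<le> card A \<Longrightarrow> upd_R A w m \<le> \<alpha> \<Longrightarrow> m \<le> n"
proof -
  let ?Q = "{n. n \<le> card A \<and> upd_R A w n \<le> \<alpha>}"
  have fin: "finite ?Q" by (rule finite_subset[of _ "{..card A}"]) auto
  moreover have "0 \<in> ?Q" using assms by (simp add: upd_R_def)
  ultimately have "Max ?Q \<in> ?Q" by (intro Max_in) auto
  then show ?thesis
    using that[of "Max ?Q"] Max_ge[OF fin] by (auto simp: update_rule_def Let_def)
qed

lemma upd_R_le_iff:
  assumes "finite A" "n \<le> card A" "0 \<le> \<alpha>"
  shows "upd_R A w n \<le> \<alpha> \<longleftrightarrow> feasible \<alpha> {k \<in> A. upd_rank A w k < n} w"
  unfolding upd_R_def feasible_def card_upd_rank_less[OF assms(1,2)]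
  using assms(3) by (auto simp: divide_simps)

lemma update_rule_subset: "update_rule \<alpha> A w \<subseteq> A"
  by (auto simp: update_rule_def Let_def)

lemma feasible_update_rule:
  assumes "finite A" "0 \<le> \<alpha>"
  shows "feasible \<alpha> (update_rule \<alpha> A w) w"
  by (rule update_rule_lowest[OF assms, of w]) (use assms in \<open>auto simp: upd_R_le_iff\<close>)

text \<open>Exchanging \<open>C\<close> for the \<open>card C\<close> lowest streams can only lower
  the sum of posteriors. So \<open>card C\<close> is an admissible cut-off, hence at most the one
  chosen by the rule, and \<open>lowest_dominates\<close> applies.\<close>

lemma update_rule_dominates:
  assumes "finite A" "0 \<le> \<alpha>" "C \<subseteq> A" "feasible \<alpha> C w"
  shows "dominates (update_rule \<alpha> A w) w C w"
proof -
  obtain n where n: "n \<le> card A" "update_rule \<alpha> A w = {k \<in> A. upd_rank A w k < n}"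
    "\<And>m. m \<le> card A \<Longrightarrow> upd_R A w m \<le> \<alpha> \<Longrightarrow> m \<le> n"
    using update_rule_lowest[OF assms(1,2), of w] by metis
  have C: "finite C" "card C \<le> card A" using assms finite_subset card_mono by blast+
  define D where "D = {k \<in> A. upd_rank A w k < card C}"
  have D: "finite D" "card D = card C"
    using assms(1) C card_upd_rank_less by (auto simp: D_def)
  obtain \<sigma> where \<sigma>: "inj_on \<sigma> C" "\<sigma> ` C \<subseteq> D" "\<And>c. c \<in> C \<Longrightarrow> w (\<sigma> c) \<le> w c"
    using lowest_dominates[OF assms(1,3) order_refl C(2), of w] unfolding dominates_def D_def by blast
  have "\<sigma> ` C = D" using \<sigma> D by (intro card_subset_eq) (auto simp: card_image)
  then have "feasible \<alpha> D w"
    using dominates_sum_le[OF \<sigma>(1), of w w] \<sigma>(3) assms(4) D(2) by (simp add: feasible_def)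
  then have "upd_R A w (card C) \<le> \<alpha>"
    using C(2) assms(1,2) by (simp add: upd_R_le_iff D_def)
  then have "card C \<le> n" by (rule n(3)[OF C(2)])
  then show ?thesis unfolding n(2) by (intro lowest_dominates assms(1,3) n(1))
qed

text \<open>The selection made in \<open>B\<close> is carried into \<open>A\<close> along the
  injection. Its image has the same size and no larger sum, so it is feasible in \<open>A\<close>,
  where the rule dominates every feasible subset.\<close>

lemma dominates_update_rule:
  assumes "finite A" "finite B" "0 \<le> \<alpha>" "dominates A u B v"
  shows "dominates (update_rule \<alpha> A u) u (update_rule \<alpha> B v) v"
proof -
  let ?B = "update_rule \<alpha> B v"
  obtain \<sigma> where \<sigma>: "inj_on \<sigma> B" "\<sigma> ` B \<subseteq> A" "\<And>b. b \<in> B \<Longrightarrow> u (\<sigma> b) \<le> v b"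
    using assms(4) unfolding dominates_def by blast
  have sub: "?B \<subseteq> B" by (rule update_rule_subset)
  have inj: "inj_on \<sigma> ?B" using \<sigma>(1) sub inj_on_subset by blast
  have "feasible \<alpha> (\<sigma> ` ?B) u"
    using dominates_sum_le[OF inj, of u v] \<sigma>(3) sub feasible_update_rule[OF assms(2,3), of v]
    by (force simp: feasible_def card_image[OF inj])
  then have "dominates (update_rule \<alpha> A u) u (\<sigma> ` ?B) u"
    using \<sigma>(2) sub assms by (intro update_rule_dominates) auto
  moreover have "dominates (\<sigma> ` ?B) u ?B v"
    unfolding dominates_def using inj \<sigma>(3) sub by blast
  ultimately show ?thesis by (rule dominates_trans)
qed

lemma dominates_card_le:
  assumes "finite A" "dominates A u B v"
  shows "card B \<le> card A"
  using assms unfolding dominates_def by (metis card_inj_on_le)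

text \<open>Almost sure equality of \<open>posterior\<close> and \<open>V\<close> is known only for
  active streams; this lemma lets them be exchanged inside the rule.\<close>

lemma update_rule_cong:
  assumes "\<And>k. k \<in> A \<Longrightarrow> w k = w' k"
  shows "update_rule \<alpha> A w = update_rule \<alpha> A w'"
proof -
  have r: "upd_rank A w k = upd_rank A w' k" if "k \<in> A" for k
    unfolding upd_rank_def using assms that by (auto intro!: arg_cong[of _ _ card])
  have s: "{k \<in> A. upd_rank A w k < n} = {k \<in> A. upd_rank A w' k < n}" for n
    using r by auto
  have "upd_R A w = upd_R A w'"
    unfolding upd_R_def s using assms by (intro ext) (auto intro!: sum.cong arg_cong2[of _ _ _ _ "(/)"])
  then show ?thesis by (simp add: update_rule_def s)
qed

text \<open>For fixed \<open>A\<close> the ranks and averages become finite sums of conditionals,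
  and the choice of the maximum becomes a finite Boolean combination of inequalities between
  measurable functions.\<close>

lemma sets_update_rule_eq:
  assumes "finite A" "0 \<le> \<alpha>" and [measurable]: "\<And>k. k \<in> A \<Longrightarrow> W k \<in> borel_measurable F"
  shows "{x \<in> space F. update_rule \<alpha> A (\<lambda>k. W k x) = C} \<in> sets F"
proof -
  have rank: "upd_rank A w k = (\<Sum>j\<in>A. if w j < w k \<or> (w j = w k \<and> j < k) then 1 else 0)" for w k
    unfolding upd_rank_def using assms(1) by (simp add: sum.If_cases Int_def)
  have rank_meas[measurable]: "(\<lambda>x. upd_rank A (\<lambda>k. W k x) k) \<in> measurable F (count_space UNIV)" if "k \<in> A" for k
    unfolding rank using that by measurable
  have R: "upd_R A w n = (if n = 0 then 0 else (\<Sum>k\<in>A. if upd_rank A w k < n then w k else 0) / real n)" for w n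
    unfolding upd_R_def using assms(1)
    by (auto simp: sum.If_cases Int_def intro!: arg_cong2[of _ _ _ _ "(/)"] sum.cong)
  have R_meas[measurable]: "(\<lambda>x. upd_R A (\<lambda>k. W k x) n) \<in> borel_measurable F" for n
    unfolding R by measurable
  have eq: "update_rule \<alpha> A w = C \<longleftrightarrow> C \<subseteq> A \<and>
     (\<exists>n\<in>{..card A}. upd_R A w n \<le> \<alpha> \<and> (\<forall>m\<in>{..card A}. upd_R A w m \<le> \<alpha> \<longrightarrow> m \<le> n) \<and>
        (\<forall>k\<in>A. upd_rank A w k < n \<longleftrightarrow> k \<in> C))" for w
  proof -
    obtain n where n: "n \<le> card A" "upd_R A w n \<le> \<alpha>" "update_rule \<alpha> A w = {k \<in> A. upd_rank A w k < n}"
      "\<And>m. m \<le> card A \<Longrightarrow> upd_R A w m \<le> \<alpha> \<Longrightarrow> m \<le> n"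
      using update_rule_lowest[OF assms(1,2), of w] by metis
    show ?thesis
    proof
      assume "update_rule \<alpha> A w = C"
      then show "C \<subseteq> A \<and>
       (\<exists>n\<in>{..card A}. upd_R A w n \<le> \<alpha> \<and> (\<forall>m\<in>{..card A}. upd_R A w m \<le> \<alpha> \<longrightarrow> m \<le> n) \<and>
        (\<forall>k\<in>A. upd_rank A w k < n \<longleftrightarrow> k \<in> C))"
        using n by (intro conjI bexI[of _ n]) auto
    next
      assume *: "C \<subseteq> A \<and>
       (\<exists>n\<in>{..card A}. upd_R A w n \<le> \<alpha> \<and> (\<forall>m\<in>{..card A}. upd_R A w m \<le> \<alpha> \<longrightarrow> m \<le> n) \<and>
        (\<forall>k\<in>A. upd_rank A w k < n \<longleftrightarrow> k \<in> C))"
      then obtain n' where n': "n' \<le> card A" "upd_R A w n' \<le> \<alpha>"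
        "\<And>m. m \<le> card A \<Longrightarrow> upd_R A w m \<le> \<alpha> \<Longrightarrow> m \<le> n'" "\<And>k. k \<in> A \<Longrightarrow> upd_rank A w k < n' \<longleftrightarrow> k \<in> C"
        by auto
      have "n' = n" using n n' by (simp add: order_antisym)
      then show "update_rule \<alpha> A w = C" using n n' * by auto
    qed
  qed
  show ?thesis unfolding eq using assms(1) by measurable
qed

section \<open>The posterior kernel and the value of the greedy procedure\<close>

text \<open>One coordinate is integrated out at a time. With the others fixed, \<open>F\<close> is
  antitone in the new one, so \<open>dom\<close> applies; the partial integral is again antitone,
  and still at most \<open>b\<close> because \<open>P i\<close> has mass one. The bound is carried
  along because monotonicity of the posterior kernel is proved for test functions with a finite
  bound.\<close>

lemma nn_integral_PiM_mono_kernel: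
  fixes P Q :: "'i \<Rightarrow> real measure" and F :: "('i \<Rightarrow> real) \<Rightarrow> ennreal"
  assumes "finite I"
    and P: "\<And>i. prob_space (P i)" "\<And>i. sets (P i) = sets borel"
    and Q: "\<And>i. prob_space (Q i)" "\<And>i. sets (Q i) = sets borel"
    and dom: "\<And>i \<phi>. i \<in> I \<Longrightarrow> antimono \<phi> \<Longrightarrow> \<phi> \<in> borel_measurable borel \<Longrightarrow> (\<And>x. \<phi> x \<le> b) \<Longrightarrow>
           (\<integral>\<^sup>+x. \<phi> x \<partial>Q i) \<le> (\<integral>\<^sup>+x. \<phi> x \<partial>P i)"
    and "F \<in> borel_measurable (PiM I (\<lambda>_. borel))"
    and "\<And>x y. x \<in> extensional I \<Longrightarrow> y \<in> extensional I \<Longrightarrow> (\<And>i. i \<in> I \<Longrightarrow> x i \<le> y i) \<Longrightarrow> F y \<le> F x"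
    and "\<And>x. F x \<le> b"
  shows "(\<integral>\<^sup>+x. F x \<partial>PiM I Q) \<le> (\<integral>\<^sup>+x. F x \<partial>PiM I P)"
  using assms(1) dom assms(7-9)
proof (induction I arbitrary: F rule: finite_induct)
  case empty
  then show ?case by (simp add: PiM_empty nn_integral_count_space_finite)
next
  case (insert i I)
  interpret P: product_sigma_finite P using P(1) by (simp add: product_sigma_finite_def prob_space_imp_sigma_finite)
  interpret Q: product_sigma_finite Q using Q(1) by (simp add: product_sigma_finite_def prob_space_imp_sigma_finite)
  interpret Pi: prob_space "P i" by (rule P)
  have sets_PQ: "sets (PiM J P) = sets (PiM J (\<lambda>_. borel))" "sets (PiM J Q) = sets (PiM J (\<lambda>_. borel))" for J
    using P Q by (auto intro!: sets_PiM_cong)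
  note [measurable] = insert.prems(2)
  note [measurable_cong] = sets_PQ P(2) Q(2)
  define F' where "F' x = (\<integral>\<^sup>+y. F (x(i := y)) \<partial>P i)" for x
  have [measurable]: "F' \<in> borel_measurable (PiM I (\<lambda>_. borel))"
    unfolding F'_def by measurable
  have ext: "x(i := y) \<in> extensional (insert i I)" if "x \<in> extensional I" for x :: "'i \<Rightarrow> real" and y
    using that by (auto simp: extensional_def)
  have "(\<integral>\<^sup>+x. F x \<partial>PiM (insert i I) Q) = (\<integral>\<^sup>+x. \<integral>\<^sup>+y. F (x(i := y)) \<partial>Q i \<partial>PiM I Q)"
    using insert.hyps by (intro Q.product_nn_integral_insert) auto
  also have "\<dots> \<le> (\<integral>\<^sup>+x. F' x \<partial>PiM I Q)"
  proof (rule nn_integral_mono)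
    fix x assume x[measurable]: "x \<in> space (PiM I Q)"
    then have xe: "x \<in> extensional I" by (auto simp: space_PiM PiE_def)
    have x'[measurable]: "x \<in> space (PiM I (\<lambda>_. borel))" using x sets_eq_imp_space_eq[OF sets_PQ(2)] by blast
    show "(\<integral>\<^sup>+y. F (x(i := y)) \<partial>Q i) \<le> F' x" unfolding F'_def
    proof (rule insert.prems(1))
      show "antimono (\<lambda>y. F (x(i := y)))"
        by (intro antimonoI insert.prems(3) ext[OF xe]) auto
      show "(\<lambda>y. F (x(i := y))) \<in> borel_measurable borel" by measurable
    qed (auto intro: insert.prems)
  qed
  also have "\<dots> \<le> (\<integral>\<^sup>+x. F' x \<partial>PiM I P)"
  proof (rule insert.IH)
    show "F' y \<le> F' x" if "x \<in> extensional I" "y \<in> extensional I" "\<And>i. i \<in> I \<Longrightarrow> x i \<le> y i" for x y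
      unfolding F'_def using that by (intro nn_integral_mono insert.prems(3) ext) auto
    show "F' x \<le> b" for x
    proof -
      have "F' x \<le> (\<integral>\<^sup>+y. b \<partial>P i)"
        unfolding F'_def by (intro nn_integral_mono insert.prems)
      then show ?thesis by (simp add: Pi.emeasure_space_1)
    qed
  qed (use insert.prems in auto)
  also have "\<dots> = (\<integral>\<^sup>+x. F x \<partial>PiM (insert i I) P)"
    unfolding F'_def using insert.hyps by (intro P.product_nn_integral_insert[symmetric]) auto
  finally show ?case .
qed

section \<open>Bayes update for a single stream\<close>

locale shift_kernel = prob_space \<nu> for \<nu> :: "'x measure" +
  fixes p q :: "'x \<Rightarrow> real" and \<theta> :: real
  assumes p_nonneg: "0 \<le> p x" and q_nonneg: "0 \<le> q x"
    and p_meas[measurable]: "p \<in> borel_measurable \<nu>" and q_meas[measurable]: "q \<in> borel_measurable \<nu>"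
    and p_int: "(\<integral>\<^sup>+x. ennreal (p x) \<partial>\<nu>) = 1" and q_int: "(\<integral>\<^sup>+x. ennreal (q x) \<partial>\<nu>) = 1"
    and theta: "0 < \<theta>" "\<theta> < 1"
begin

text \<open>The clipping is harmless, as posterior probabilities lie in \<open>[0, 1]\<close>; it makes \<open>kern w\<close> a probability
  measure for every real \<open>w\<close>.\<close>

definition chg :: "real \<Rightarrow> real" where
  "chg w = (let c = min 1 (max 0 w) in c + \<theta> * (1 - c))"

text \<open>If \<open>w\<close> is the probability of \<open>\<tau> < t\<close>, then
  \<open>chg w\<close> is that of \<open>\<tau> \<le> t\<close>: a geometric change point that has
  not occurred before \<open>t\<close> equals \<open>t\<close> with probability \<theta>. This is
  the event that observation \<open>t + 1\<close> follows \<open>q\<close>, so the mixture is its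
  predictive density.\<close>

definition pred_dens :: "real \<Rightarrow> 'x \<Rightarrow> real" where
  "pred_dens w x = (1 - chg w) * p x + chg w * q x"

text \<open>Bayes' rule for \<open>\<tau> \<le> t\<close> after observation \<open>t + 1\<close>.
  Where the predictive density vanishes, division yields 0.\<close>

definition post_next :: "real \<Rightarrow> 'x \<Rightarrow> real" where
  "post_next w x = chg w * q x / pred_dens w x"

definition kern :: "real \<Rightarrow> real measure" where
  "kern w = distr (density \<nu> (\<lambda>x. ennreal (pred_dens w x))) borel (post_next w)"

lemma chg_mono:
  assumes "u \<le> v"
  shows "chg u \<le> chg v"
proof -
  define c d where "c = min 1 (max 0 u)" and "d = min 1 (max 0 v)"
  have "(1 - \<theta>) * c \<le> (1 - \<theta>) * d"
    using theta assms by (intro mult_left_mono) (auto simp: c_def d_def)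
  then show ?thesis by (simp add: chg_def Let_def algebra_simps flip: c_def d_def)
qed

lemma chg_bounds: "0 < chg w" "chg w \<le> 1"
proof -
  define c where "c = min 1 (max 0 w)"
  have "0 \<le> (1 - \<theta>) * c" "(1 - \<theta>) * c \<le> (1 - \<theta>) * 1"
    using theta by (auto intro!: mult_left_mono mult_nonneg_nonneg simp: c_def)
  then show "0 < chg w" "chg w \<le> 1"
    using theta by (simp_all add: chg_def Let_def algebra_simps flip: c_def)
qed

lemma chg_eq: "0 \<le> w \<Longrightarrow> w \<le> 1 \<Longrightarrow> chg w = w + \<theta> * (1 - w)"
  by (simp add: chg_def)

lemma chg_meas[measurable]: "chg \<in> borel_measurable borel"
  unfolding chg_def Let_def by measurable

lemma pred_dens_nonneg: "0 \<le> pred_dens w x"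
  unfolding pred_dens_def using chg_bounds[of w] p_nonneg q_nonneg by (intro add_nonneg_nonneg mult_nonneg_nonneg) auto

lemma pred_dens_meas[measurable (raw)]:
  assumes [measurable]: "w \<in> borel_measurable Z" "x \<in> measurable Z \<nu>"
  shows "(\<lambda>z. pred_dens (w z) (x z)) \<in> borel_measurable Z"
  unfolding pred_dens_def by measurable

lemma post_next_meas[measurable (raw)]:
  assumes [measurable]: "w \<in> borel_measurable Z" "x \<in> measurable Z \<nu>"
  shows "(\<lambda>z. post_next (w z) (x z)) \<in> borel_measurable Z"
  unfolding post_next_def by measurable

text \<open>Bayes' rule without division. It survives a zero predictive density: both nonnegative
  summands then vanish, hence also the numerator.\<close>

lemma post_next_pred_dens: "post_next w x * pred_dens w x = chg w * q x"
proof (cases "pred_dens w x = 0")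
  case True
  have "0 \<le> chg w * q x" "0 \<le> (1 - chg w) * p x"
    using chg_bounds[of w] p_nonneg q_nonneg by auto
  then have "chg w * q x = 0" using True unfolding pred_dens_def by linarith
  then show ?thesis by (simp only: True mult_zero_right)
qed (simp add: post_next_def)

lemma post_next_bounds: "0 \<le> post_next w x" "post_next w x \<le> 1"
proof -
  have "0 \<le> chg w * q x" "0 \<le> (1 - chg w) * p x"
    using chg_bounds[of w] p_nonneg q_nonneg by auto
  then show "0 \<le> post_next w x" "post_next w x \<le> 1"
    unfolding post_next_def pred_dens_def by (auto simp: divide_simps)
qed

text \<open>After cross-multiplication the terms with \<open>chg u * chg v\<close> cancel, and
  \<open>chg u * p x * q x \<le> chg v * p x * q x\<close> remains.\<close>

lemma post_next_mono:
  assumes "u \<le> v"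
  shows "post_next u x \<le> post_next v x"
proof (cases "q x = 0")
  case False
  then have q: "0 < q x" using q_nonneg[of x] by simp
  have pos: "0 < pred_dens w x" for w
    unfolding pred_dens_def using chg_bounds[of w] p_nonneg[of x] q
    by (intro add_nonneg_pos mult_nonneg_nonneg mult_pos_pos) auto
  have "chg u * p x * q x \<le> chg v * p x * q x"
    using chg_mono[OF assms] p_nonneg[of x] q by (intro mult_right_mono) auto
  then have "chg u * q x * pred_dens v x \<le> chg v * q x * pred_dens u x"
    by (simp add: pred_dens_def algebra_simps)
  then show ?thesis unfolding post_next_def using pos by (simp add: divide_simps)
qed (simp add: post_next_def)

text \<open>When \<open>q x\<close> is the larger density, the mixture \<open>pred_dens v x\<close>
  is at most \<open>q x\<close>, so the factor multiplying \<open>chg v\<close> is at least 1.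
  Positivity of \<open>q x\<close> excludes points where both densities vanish, at which
  \<open>post_next\<close> is 0.\<close>

lemma post_next_ge_chg:
  assumes "p x \<le> q x" "0 < q x"
  shows "chg v \<le> post_next v x"
proof -
  have pos: "0 < pred_dens v x"
    unfolding pred_dens_def using chg_bounds[of v] p_nonneg[of x] assms(2)
    by (intro add_nonneg_pos mult_nonneg_nonneg mult_pos_pos) auto
  have "(1 - chg v) * p x \<le> (1 - chg v) * q x" using assms chg_bounds[of v] by (intro mult_left_mono) auto
  then have "pred_dens v x \<le> q x" by (simp add: pred_dens_def algebra_simps)
  then show ?thesis using pos chg_bounds[of v] by (simp add: post_next_def divide_simps)
qed

lemma post_next_le_chg:
  assumes "q x \<le> p x"
  shows "post_next v x \<le> chg v"
proof -
  have "(1 - chg v) * q x \<le> (1 - chg v) * p x" using assms chg_bounds[of v] by (intro mult_left_mono) auto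
  then have "q x \<le> pred_dens v x" by (simp add: pred_dens_def algebra_simps)
  then show ?thesis using chg_bounds[of v] pred_dens_nonneg[of v x] by (simp add: post_next_def divide_simps)
qed

lemma pred_dens_int: "(\<integral>\<^sup>+x. ennreal (pred_dens w x) \<partial>\<nu>) = 1"
proof -
  have "(\<integral>\<^sup>+x. ennreal (pred_dens w x) \<partial>\<nu>)
      = (\<integral>\<^sup>+x. ennreal (1 - chg w) * ennreal (p x) + ennreal (chg w) * ennreal (q x) \<partial>\<nu>)"
    unfolding pred_dens_def using chg_bounds[of w] p_nonneg q_nonneg
    by (intro nn_integral_cong) (simp add: ennreal_plus ennreal_mult mult_nonneg_nonneg)
  also have "\<dots> = ennreal (1 - chg w) + ennreal (chg w)"
    by (simp add: nn_integral_add nn_integral_cmult p_int q_int)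
  also have "\<dots> = 1" using chg_bounds[of w] by (simp flip: ennreal_plus)
  finally show ?thesis .
qed

lemma prob_space_kern: "prob_space (kern w)"
  unfolding kern_def
proof (rule prob_space.prob_space_distr)
  show "prob_space (density \<nu> (\<lambda>x. ennreal (pred_dens w x)))"
  proof (rule prob_spaceI)
    have "emeasure (density \<nu> (\<lambda>x. ennreal (pred_dens w x))) (space \<nu>) =
        (\<integral>\<^sup>+x. ennreal (pred_dens w x) * indicator (space \<nu>) x \<partial>\<nu>)"
      by (rule emeasure_density) auto
    also have "\<dots> = (\<integral>\<^sup>+x. ennreal (pred_dens w x) \<partial>\<nu>)"
      by (intro nn_integral_cong) simp
    finally show "emeasure (density \<nu> (\<lambda>x. ennreal (pred_dens w x)))
        (space (density \<nu> (\<lambda>x. ennreal (pred_dens w x)))) = 1"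
      by (simp add: pred_dens_int)
  qed
qed simp

lemma sets_kern[simp, measurable_cong]: "sets (kern w) = sets borel"
  by (simp add: kern_def)

lemma nn_integral_kern:
  assumes [measurable]: "\<phi> \<in> borel_measurable borel"
  shows "(\<integral>\<^sup>+y. \<phi> y \<partial>kern w) = (\<integral>\<^sup>+x. ennreal (pred_dens w x) * \<phi> (post_next w x) \<partial>\<nu>)"
  unfolding kern_def by (simp add: nn_integral_distr nn_integral_density)

text \<open>Both the updated posterior and the sign of \<open>q - p\<close> are governed by the likelihood ratio, so
  \<open>\<phi> (post_next v x) - \<phi> (chg v)\<close> and \<open>p x - q x\<close> have the same sign.\<close>

lemma kern_antimono_le:
  assumes uv: "u \<le> v" and \<phi>: "antimono \<phi>" "\<And>x. \<phi> x \<le> b" and b: "b < \<top>"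
    and [measurable]: "\<phi> \<in> borel_measurable borel"
  shows "(\<integral>\<^sup>+y. \<phi> y \<partial>kern v) \<le> (\<integral>\<^sup>+y. \<phi> y \<partial>kern u)"
proof -
  define \<delta> where "\<delta> = chg v - chg u"
  have \<delta>: "0 \<le> \<delta>" using chg_mono[OF uv] by (simp add: \<delta>_def)
  have fin: "\<phi> x < \<top>" for x using \<phi>(2) b le_less_trans by blast
  \<comment> \<open>Passing from \<open>u\<close> to \<open>v\<close> changes the predictive density
    by \<open>\<delta> * (q x - p x)\<close>, which has integral zero, so the change may be tested
    against \<phi> minus any constant. With the value at \<open>chg v\<close> as constant the
    product has a sign at every point. Negative terms are moved across to stay in
    \<open>ennreal\<close>.\<close>
  define c where "c = \<phi> (chg v)"
  have pt: "ennreal (pred_dens v x) * \<phi> (post_next v x) + ennreal \<delta> * c * ennreal (p x)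
      \<le> ennreal (pred_dens u x) * \<phi> (post_next u x) + ennreal \<delta> * c * ennreal (q x)" for x
  proof -
    obtain c' where c': "c = ennreal c'" "0 \<le> c'" using fin[of "chg v"] unfolding c_def by (cases "\<phi> (chg v)") auto
    obtain s where s: "\<phi> (post_next v x) = ennreal s" "0 \<le> s"
      using fin[of "post_next v x"] by (cases "\<phi> (post_next v x)") auto
    have sgn: "(q x - p x) * s \<le> (q x - p x) * c'"
    \<comment> \<open>Points where both densities vanish go to the second case:
      \<open>post_next\<close> is 0 there, which is below \<open>chg v\<close>.\<close>
    proof (cases "p x \<le> q x \<and> 0 < q x")
      case True
      then have "ennreal s \<le> ennreal c'"
        using antimonoD[OF \<phi>(1) post_next_ge_chg[of x v]] by (simp add: s c'(1)[symmetric] c_def)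
      with True c' show ?thesis by (intro mult_left_mono) auto
    next
      case False
      then have le: "q x \<le> p x" using q_nonneg[of x] p_nonneg[of x] by auto
      then have "ennreal c' \<le> ennreal s"
        using antimonoD[OF \<phi>(1) post_next_le_chg[of x v]] by (simp add: s c'(1)[symmetric] c_def)
      with le s show ?thesis by (intro mult_left_mono_neg) auto
    qed
    have "\<delta> * ((q x - p x) * s) \<le> \<delta> * ((q x - p x) * c')" using sgn \<delta> by (rule mult_left_mono)
    then have "pred_dens v x * s + \<delta> * c' * p x \<le> pred_dens u x * s + \<delta> * c' * q x"
      by (simp add: pred_dens_def \<delta>_def algebra_simps)
    then have "ennreal (pred_dens v x * s + \<delta> * c' * p x) \<le> ennreal (pred_dens u x * s + \<delta> * c' * q x)"
      by (rule ennreal_leI)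
    then have "ennreal (pred_dens v x) * \<phi> (post_next v x) + ennreal \<delta> * c * ennreal (p x)
      \<le> ennreal (pred_dens u x) * \<phi> (post_next v x) + ennreal \<delta> * c * ennreal (q x)"
      using pred_dens_nonneg[of u x] pred_dens_nonneg[of v x] \<delta> s c' p_nonneg[of x] q_nonneg[of x]
      by (simp add: ennreal_plus ennreal_mult mult_nonneg_nonneg)
    also have "\<dots> \<le> ennreal (pred_dens u x) * \<phi> (post_next u x) + ennreal \<delta> * c * ennreal (q x)"
      using antimonoD[OF \<phi>(1) post_next_mono[OF uv, of x]] by (intro add_right_mono mult_left_mono) auto
    finally show ?thesis .
  qed
  have "(\<integral>\<^sup>+y. \<phi> y \<partial>kern v) + ennreal \<delta> * c
      = (\<integral>\<^sup>+x. ennreal (pred_dens v x) * \<phi> (post_next v x) + ennreal \<delta> * c * ennreal (p x) \<partial>\<nu>)"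
    by (simp add: nn_integral_kern nn_integral_add nn_integral_cmult p_int)
  also have "\<dots> \<le> (\<integral>\<^sup>+x. ennreal (pred_dens u x) * \<phi> (post_next u x) + ennreal \<delta> * c * ennreal (q x) \<partial>\<nu>)"
    by (intro nn_integral_mono pt)
  also have "\<dots> = (\<integral>\<^sup>+y. \<phi> y \<partial>kern u) + ennreal \<delta> * c"
    by (simp add: nn_integral_kern nn_integral_add nn_integral_cmult q_int)
  finally have "ennreal \<delta> * c + (\<integral>\<^sup>+y. \<phi> y \<partial>kern v) \<le> ennreal \<delta> * c + (\<integral>\<^sup>+y. \<phi> y \<partial>kern u)"
    by (simp add: add.commute)
  moreover have "ennreal \<delta> * c < \<top>" using fin[of "chg v"] by (simp add: c_def ennreal_mult_less_top)
  ultimately show ?thesis by (auto simp: ennreal_add_left_cancel_le)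
qed

section \<open>Products of kernels\<close>

text \<open>Checked on boxes, where both sides factor. The base measure
  \<open>PiM C (\<lambda>_. \<nu>)\<close> does not involve \<open>w\<close>: the dependence on the
  posteriors moves into the integrand, which is what makes kernel integrals measurable in
  \<open>w\<close>.\<close>

lemma PiM_kern:
  assumes "finite C"
  shows "PiM C (\<lambda>k. kern (w k)) =
    distr (density (PiM C (\<lambda>_. \<nu>)) (\<lambda>x. \<Prod>k\<in>C. ennreal (pred_dens (w k) (x k))))
      (PiM C (\<lambda>_. borel)) (\<lambda>x. \<lambda>k\<in>C. post_next (w k) (x k))" (is "_ = ?D")
proof -
  interpret kern: product_sigma_finite "\<lambda>k. kern (w k)"
    by (simp add: product_sigma_finite_def prob_space_imp_sigma_finite prob_space_kern)
  interpret nu: product_sigma_finite "\<lambda>_. \<nu>" by standard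
  show ?thesis
  proof (rule sym, rule kern.PiM_eqI[OF assms])
    show "sets ?D = sets (PiM C (\<lambda>k. kern (w k)))" by (simp cong: sets_PiM_cong)
    fix A assume A: "\<And>k. k \<in> C \<Longrightarrow> A k \<in> sets (kern (w k))"
    then have A'[measurable]: "\<And>k. k \<in> C \<Longrightarrow> A k \<in> sets borel" by simp
    have [measurable]: "PiE C A \<in> sets (PiM C (\<lambda>_. borel))"
      using assms A' by (intro sets_PiM_I_finite) auto
    have "emeasure ?D (PiE C A) = (\<integral>\<^sup>+y. indicator (PiE C A) y \<partial>?D)"
      by simp
    also have "\<dots> = (\<integral>\<^sup>+x. (\<Prod>k\<in>C. ennreal (pred_dens (w k) (x k))) *
        indicator (PiE C A) (\<lambda>k\<in>C. post_next (w k) (x k)) \<partial>PiM C (\<lambda>_. \<nu>))"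
      using assms by (subst nn_integral_distr, measurable, subst nn_integral_density) auto
    also have "\<dots> = (\<integral>\<^sup>+x. (\<Prod>k\<in>C. ennreal (pred_dens (w k) (x k)) * indicator (A k) (post_next (w k) (x k))) \<partial>PiM C (\<lambda>_. \<nu>))"
    proof (intro nn_integral_cong)
      fix x
      have "indicator (PiE C A) (\<lambda>k\<in>C. post_next (w k) (x k)) = (\<Prod>k\<in>C. indicator (A k) (post_next (w k) (x k)) :: ennreal)"
        using assms by (auto simp: indicator_def PiE_iff prod_zero_iff)
      then show "(\<Prod>k\<in>C. ennreal (pred_dens (w k) (x k))) * indicator (PiE C A) (\<lambda>k\<in>C. post_next (w k) (x k)) =
         (\<Prod>k\<in>C. ennreal (pred_dens (w k) (x k)) * indicator (A k) (post_next (w k) (x k)))"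
        by (simp add: prod.distrib)
    qed
    also have "\<dots> = (\<Prod>k\<in>C. \<integral>\<^sup>+x. ennreal (pred_dens (w k) x) * indicator (A k) (post_next (w k) x) \<partial>\<nu>)"
      using assms by (intro nu.product_nn_integral_prod) auto
    also have "\<dots> = (\<Prod>k\<in>C. emeasure (kern (w k)) (A k))"
      by (intro prod.cong refl) (simp flip: nn_integral_kern)
    finally show "emeasure ?D (PiE C A) = (\<Prod>k\<in>C. emeasure (kern (w k)) (A k))" .
  qed
qed

lemma nn_integral_PiM_kern:
  assumes "finite C" and [measurable]: "F \<in> borel_measurable (PiM C (\<lambda>_. borel))"
  shows "(\<integral>\<^sup>+y. F y \<partial>PiM C (\<lambda>k. kern (w k))) =
    (\<integral>\<^sup>+x. (\<Prod>k\<in>C. ennreal (pred_dens (w k) (x k))) * F (\<lambda>k\<in>C. post_next (w k) (x k)) \<partial>PiM C (\<lambda>_. \<nu>))"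
  unfolding PiM_kern[OF assms(1)]
  using assms(1) by (subst nn_integral_distr, measurable, subst nn_integral_density) auto

lemma measurable_nn_integral_PiM_kern:
  assumes "finite C" and [measurable]: "F \<in> borel_measurable (PiM C (\<lambda>_. borel))"
    and [measurable]: "\<And>k. k \<in> C \<Longrightarrow> W k \<in> borel_measurable Z"
  shows "(\<lambda>z. \<integral>\<^sup>+y. F y \<partial>PiM C (\<lambda>k. kern (W k z))) \<in> borel_measurable Z"
proof -
  interpret nuC: prob_space "PiM C (\<lambda>_. \<nu>)" by (intro prob_space_PiM prob_space_axioms)
  show ?thesis unfolding nn_integral_PiM_kern[OF assms(1,2)] by measurable
qed

text \<open>The expected utilization in the next \<open>m\<close> steps of the greedy procedure, started with active streams \<open>A\<close> and
  posteriors \<open>w\<close>.\<close>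

primrec gval :: "real \<Rightarrow> nat \<Rightarrow> nat set \<Rightarrow> (nat \<Rightarrow> real) \<Rightarrow> ennreal" where
  "gval \<alpha> 0 A w = 0"
| "gval \<alpha> (Suc m) A w = of_nat (card (update_rule \<alpha> A w)) +
     (\<integral>\<^sup>+x. gval \<alpha> m (update_rule \<alpha> A w) x \<partial>PiM (update_rule \<alpha> A w) (\<lambda>k. kern (w k)))"

text \<open>The sets only shrink, so each step contributes at most \<open>card A\<close>. The finite
  bound is what the monotonicity of the kernel requires.\<close>

lemma gval_bound:
  assumes "finite A"
  shows "gval \<alpha> m A w \<le> of_nat (m * card A)"
  using assms
proof (induction m arbitrary: A w)
  case (Suc m)
  let ?B = "update_rule \<alpha> A w"
  have B: "finite ?B" "card ?B \<le> card A"
    using Suc.prems update_rule_subset finite_subset card_mono by metis+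
  interpret B: prob_space "PiM ?B (\<lambda>k. kern (w k))" by (intro prob_space_PiM prob_space_kern)
  have "(\<integral>\<^sup>+x. gval \<alpha> m ?B x \<partial>PiM ?B (\<lambda>k. kern (w k))) \<le> (\<integral>\<^sup>+x. of_nat (m * card A) \<partial>PiM ?B (\<lambda>k. kern (w k)))"
  proof (intro nn_integral_mono)
    fix x
    have "gval \<alpha> m ?B x \<le> of_nat (m * card ?B)" by (rule Suc.IH[OF B(1)])
    also have "\<dots> \<le> of_nat (m * card A)" using B(2) by (intro of_nat_mono) auto
    finally show "gval \<alpha> m ?B x \<le> of_nat (m * card A)" .
  qed
  also have "\<dots> = of_nat (m * card A)" by (simp add: B.emeasure_space_1)
  finally show ?case using B(2) by (auto intro!: add_mono simp: of_nat_mono)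
qed simp

text \<open>The rule takes finitely many values, the subsets of \<open>A\<close>; on each such event
  the next set is a constant \<open>C\<close>, and the integral is measurable in the parameters of
  the kernels.\<close>

lemma gval_meas_PiM:
  assumes "finite A" "0 \<le> \<alpha>"
  shows "gval \<alpha> m A \<in> borel_measurable (PiM A (\<lambda>_. borel))"
  using assms(1)
proof (induction m arbitrary: A)
  case (Suc m)
  let ?Z = "PiM A (\<lambda>_. borel :: real measure)"
  have fin: "finite C" if "C \<in> Pow A" for C using that Suc.prems(1) finite_subset by auto
  have [measurable]: "{w \<in> space ?Z. update_rule \<alpha> A w = C} \<in> sets ?Z" for C
    using sets_update_rule_eq[of A \<alpha> "\<lambda>k w. w k" ?Z] Suc.prems assms(2) by simp
  have [measurable]: "(\<lambda>w. \<integral>\<^sup>+x. gval \<alpha> m C x \<partial>PiM C (\<lambda>k. kern (w k))) \<in> borel_measurable ?Z" if "C \<in> Pow A" for C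
    using that by (intro measurable_nn_integral_PiM_kern Suc.IH fin) auto
  have "gval \<alpha> (Suc m) A w =
    (\<Sum>C\<in>Pow A. indicator {w \<in> space ?Z. update_rule \<alpha> A w = C} w *
      (of_nat (card C) + (\<integral>\<^sup>+x. gval \<alpha> m C x \<partial>PiM C (\<lambda>k. kern (w k)))))" if "w \<in> space ?Z" for w
    using that Suc.prems(1) update_rule_subset[of \<alpha> A w]
    by (subst sum.remove[of _ "update_rule \<alpha> A w"]) (auto intro!: sum.neutral)
  then show ?case by (subst measurable_cong) measurable
next
  case 0
  have "gval \<alpha> 0 A = (\<lambda>_. 0)" by auto
  then show ?case by simp
qed

text \<open>Three moves along the injection \<sigma>: lower the posteriors of \<open>B\<close> to
  those of their images, by stochastic monotonicity; realize the resulting product as the law of the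
  coordinates \<open>\<sigma> b\<close> under the product over \<open>A\<close>, all streams sharing
  one kernel; compare pointwise, since a point of that product dominates its own reindexing.
  Monotonicity of \<open>gval\<close> is an assumption so that the lemma can be used inside the
  induction that proves it.\<close>

lemma nn_integral_gval_mono:
  assumes "finite A" "finite B" "0 \<le> \<alpha>" "dominates A u B v"
    and mono: "\<And>x y. dominates A x B y \<Longrightarrow> gval \<alpha> m B y \<le> gval \<alpha> m A x"
      "\<And>x y. dominates B x B y \<Longrightarrow> gval \<alpha> m B y \<le> gval \<alpha> m B x"
  shows "(\<integral>\<^sup>+x. gval \<alpha> m B x \<partial>PiM B (\<lambda>k. kern (v k))) \<le> (\<integral>\<^sup>+x. gval \<alpha> m A x \<partial>PiM A (\<lambda>k. kern (u k)))"
proof -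
  note [measurable] = gval_meas_PiM[OF assms(2,3)] gval_meas_PiM[OF assms(1,3)]
  obtain \<sigma> where \<sigma>: "inj_on \<sigma> B" "\<sigma> ` B \<subseteq> A" "\<And>b. b \<in> B \<Longrightarrow> u (\<sigma> b) \<le> v b"
    using assms(4) unfolding dominates_def by blast
  have \<sigma>A: "\<sigma> b \<in> A" if "b \<in> B" for b using \<sigma>(2) that by auto
  have bfin: "of_nat (m * card B) < (\<top> :: ennreal)" by (rule of_nat_less_top)
  have "(\<integral>\<^sup>+x. gval \<alpha> m B x \<partial>PiM B (\<lambda>k. kern (v k))) \<le> (\<integral>\<^sup>+x. gval \<alpha> m B x \<partial>PiM B (\<lambda>k. kern (u (\<sigma> k))))"
  proof (rule nn_integral_PiM_mono_kernel[where b = "of_nat (m * card B)"])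
    fix i and \<phi> :: "real \<Rightarrow> ennreal"
    assume "i \<in> B" "antimono \<phi>" "\<phi> \<in> borel_measurable borel" "\<And>x. \<phi> x \<le> of_nat (m * card B)"
    then show "(\<integral>\<^sup>+x. \<phi> x \<partial>kern (v i)) \<le> (\<integral>\<^sup>+x. \<phi> x \<partial>kern (u (\<sigma> i)))"
      using kern_antimono_le[OF \<sigma>(3) _ _ bfin] by blast
  next
    fix x y :: "nat \<Rightarrow> real" assume "\<And>i. i \<in> B \<Longrightarrow> x i \<le> y i"
    then show "gval \<alpha> m B y \<le> gval \<alpha> m B x"
      by (intro mono(2) dominates_subset) auto
  qed (use assms gval_bound prob_space_kern gval_meas_PiM in auto)
  also have "\<dots> = (\<integral>\<^sup>+x. gval \<alpha> m B x \<partial>distr (PiM A (\<lambda>k. kern (u k))) (PiM B (\<lambda>k. kern (u (\<sigma> k)))) (\<lambda>x. \<lambda>b\<in>B. x (\<sigma> b)))"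
    using distr_PiM_reindex[of A "\<lambda>k. kern (u k)" \<sigma> B] \<sigma> prob_space_kern by (simp add: image_subset_iff_funcset)
  also have "\<dots> = (\<integral>\<^sup>+x. gval \<alpha> m B (\<lambda>b\<in>B. x (\<sigma> b)) \<partial>PiM A (\<lambda>k. kern (u k)))"
  proof (rule nn_integral_distr)
    show "(\<lambda>x. \<lambda>b\<in>B. x (\<sigma> b)) \<in> measurable (PiM A (\<lambda>k. kern (u k))) (PiM B (\<lambda>k. kern (u (\<sigma> k))))"
      using \<sigma>A by (intro measurable_restrict measurable_component_singleton) auto
    show "gval \<alpha> m B \<in> borel_measurable (distr (PiM A (\<lambda>k. kern (u k))) (PiM B (\<lambda>k. kern (u (\<sigma> k)))) (\<lambda>x. \<lambda>b\<in>B. x (\<sigma> b)))"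
      by (simp cong: sets_PiM_cong)
  qed
  also have "\<dots> \<le> (\<integral>\<^sup>+x. gval \<alpha> m A x \<partial>PiM A (\<lambda>k. kern (u k)))"
    using \<sigma> by (intro nn_integral_mono mono(1)) (auto simp: dominates_def intro!: exI[of _ \<sigma>])
  finally show ?thesis .
qed

text \<open>Induction on the horizon: the rule preserves domination, which gives the larger
  immediate gain and, through the kernels, the larger future value.\<close>

lemma gval_mono:
  assumes "finite A" "finite B" "0 \<le> \<alpha>" "dominates A u B v"
  shows "gval \<alpha> m B v \<le> gval \<alpha> m A u"
  using assms(1,2,4)
proof (induction m arbitrary: A B u v)
  case (Suc m)
  let ?A = "update_rule \<alpha> A u" and ?B = "update_rule \<alpha> B v"
  have dom: "dominates ?A u ?B v" by (intro dominates_update_rule Suc.prems assms)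
  have fin: "finite ?A" "finite ?B"
    using Suc.prems update_rule_subset finite_subset by metis+
  have "(\<integral>\<^sup>+x. gval \<alpha> m ?B x \<partial>PiM ?B (\<lambda>k. kern (v k))) \<le> (\<integral>\<^sup>+x. gval \<alpha> m ?A x \<partial>PiM ?A (\<lambda>k. kern (u k)))"
    by (intro nn_integral_gval_mono fin assms(3) dom Suc.IH)
  then show ?case
    using dominates_card_le[OF fin(1) dom] by (simp add: add_mono of_nat_mono)
qed simp

lemma gval_cong:
  assumes "finite A" "0 \<le> \<alpha>" "\<And>k. k \<in> A \<Longrightarrow> u k = v k"
  shows "gval \<alpha> m A u = gval \<alpha> m A v"
  using assms by (intro antisym gval_mono dominates_subset) auto

lemma gval_meas:
  assumes "finite A" "0 \<le> \<alpha>" and [measurable]: "\<And>k. k \<in> A \<Longrightarrow> W k \<in> borel_measurable Z"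
  shows "(\<lambda>z. gval \<alpha> m A (\<lambda>k. W k z)) \<in> borel_measurable Z"
proof -
  note [measurable] = gval_meas_PiM[OF assms(1,2)]
  have "gval \<alpha> m A (\<lambda>k. W k z) = gval \<alpha> m A (\<lambda>k\<in>A. W k z)" for z
    by (intro gval_cong assms) auto
  then show ?thesis by simp
qed

text \<open>The rule's selection dominates \<open>C\<close>, so it gains at least as many streams
  now and, by \<open>nn_integral_gval_mono\<close>, at least as much later. This is the Bellman
  inequality of the problem.\<close>

lemma feasible_le_gval:
  assumes "finite A" "0 \<le> \<alpha>" "C \<subseteq> A" "feasible \<alpha> C w"
  shows "of_nat (card C) + (\<integral>\<^sup>+x. gval \<alpha> m C x \<partial>PiM C (\<lambda>k. kern (w k))) \<le> gval \<alpha> (Suc m) A w"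
proof -
  let ?A = "update_rule \<alpha> A w"
  have dom: "dominates ?A w C w" by (intro update_rule_dominates assms)
  have fin: "finite ?A" "finite C"
    using assms update_rule_subset finite_subset by metis+
  have "(\<integral>\<^sup>+x. gval \<alpha> m C x \<partial>PiM C (\<lambda>k. kern (w k))) \<le> (\<integral>\<^sup>+x. gval \<alpha> m ?A x \<partial>PiM ?A (\<lambda>k. kern (w k)))"
    by (intro nn_integral_gval_mono fin assms(2) dom gval_mono)
  then show ?thesis
    using dominates_card_le[OF fin(1) dom] by (simp add: add_mono of_nat_mono)
qed

end

section \<open>The law of the observations\<close>

text \<open>Counting measure on a finite product is the product of the counting measures. This
  distributive law separates the streams when the change points are summed out.\<close>

lemma nn_integral_count_space_PiE:
  fixes f :: "'i \<Rightarrow> 'a \<Rightarrow> ennreal"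
  assumes "finite I" "\<And>i. countable (C i)"
  shows "(\<integral>\<^sup>+m. (\<Prod>i\<in>I. f i (m i)) \<partial>count_space (PiE I C)) = (\<Prod>i\<in>I. \<integral>\<^sup>+m. f i m \<partial>count_space (C i))"
proof -
  interpret product_sigma_finite "\<lambda>i. count_space (C i)"
    using assms(2) by (simp add: product_sigma_finite_def sigma_finite_measure_count_space_countable)
  show ?thesis
    using product_nn_integral_prod[OF assms(1), of f] by (simp add: count_space_PiM_finite[OF assms])
qed

text \<open>Conditional independence given the change points is expressed through joint
  probabilities with the events that all \<open>\<tau> k\<close> have prescribed values
  \<open>m k\<close>. Countably many such events exhaust the space, as the change points are natural
  numbers.\<close>

locale change_model = shift_kernel \<nu> p q \<theta> + M: prob_space M
  for \<nu> :: "'x measure" and p q :: "'x \<Rightarrow> real" and \<theta> :: real and M :: "'w measure" +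
  fixes K :: nat and \<tau> :: "nat \<Rightarrow> 'w \<Rightarrow> nat" and X :: "nat \<Rightarrow> nat \<Rightarrow> 'w \<Rightarrow> 'x"
  assumes tau_meas: "\<And>k. k \<in> {1..K} \<Longrightarrow> \<tau> k \<in> measurable M (count_space UNIV)"
    and X_meas: "\<And>k t. k \<in> {1..K} \<Longrightarrow> 1 \<le> t \<Longrightarrow> X k t \<in> measurable M \<nu>"
    and joint_law: "\<And>(m :: nat \<Rightarrow> nat) J B. finite J \<Longrightarrow> J \<subseteq> {1..K} \<times> {1..} \<Longrightarrow> (\<And>j. j \<in> J \<Longrightarrow> B j \<in> sets \<nu>) \<Longrightarrow>
           measure M {\<omega> \<in> space M. (\<forall>k\<in>{1..K}. \<tau> k \<omega> = m k) \<and> (\<forall>(k, t)\<in>J. X k t \<omega> \<in> B (k, t))}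
           = (\<Prod>k\<in>{1..K}. \<theta> * (1 - \<theta>) ^ m k) *
             (\<Prod>(k, t)\<in>J. measure (density \<nu> (\<lambda>x. ennreal (if t \<le> m k then p x else q x))) (B (k, t)))"
begin

section \<open>Histories, likelihoods and the posterior recursion\<close>

definition obs_idx :: "nat \<Rightarrow> (nat \<times> nat) set" where
  "obs_idx t = {1..K} \<times> {1..t}"

text \<open>The record of all streams, including those that a procedure has dropped. The restriction
  makes it a point of the product space.\<close>

definition history :: "nat \<Rightarrow> 'w \<Rightarrow> nat \<times> nat \<Rightarrow> 'x" where
  "history t \<omega> = (\<lambda>j\<in>obs_idx t. X (fst j) (snd j) \<omega>)"

abbreviation hist_space :: "nat \<Rightarrow> (nat \<times> nat \<Rightarrow> 'x) measure" where
  "hist_space t \<equiv> PiM (obs_idx t) (\<lambda>_. \<nu>)"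

definition dens :: "nat \<Rightarrow> nat \<Rightarrow> 'x \<Rightarrow> real" where
  "dens m t x = (if t \<le> m then p x else q x)"

text \<open>\<open>vpost k t\<close> is the posterior probability of \<open>\<tau> k < t\<close> given the first \<open>t\<close> observations of stream \<open>k\<close>, and
  \<open>lik k t\<close> is their marginal density.\<close>

primrec vpost :: "nat \<Rightarrow> nat \<Rightarrow> (nat \<times> nat \<Rightarrow> 'x) \<Rightarrow> real" where
  "vpost k 0 x = 0"
| "vpost k (Suc t) x = post_next (vpost k t x) (x (k, Suc t))"

primrec lik :: "nat \<Rightarrow> nat \<Rightarrow> (nat \<times> nat \<Rightarrow> 'x) \<Rightarrow> real" where
  "lik k 0 x = 1"
| "lik k (Suc t) x = lik k t x * pred_dens (vpost k t x) (x (k, Suc t))"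

lemma finite_obs_idx[simp]: "finite (obs_idx t)"
  by (simp add: obs_idx_def)

lemma history_meas[measurable]: "history t \<in> measurable M (hist_space t)"
  unfolding history_def by (intro measurable_restrict X_meas) (auto simp: obs_idx_def)

lemma dens_nonneg: "0 \<le> dens m t x"
  by (simp add: dens_def p_nonneg q_nonneg)

lemma dens_meas[measurable]: "dens m t \<in> borel_measurable \<nu>"
  unfolding dens_def by measurable

lemma dens_int: "(\<integral>\<^sup>+x. ennreal (dens m t x) \<partial>\<nu>) = 1"
  by (cases "t \<le> m") (simp_all add: dens_def p_int q_int)

lemma vpost_bounds: "0 \<le> vpost k t x" "vpost k t x \<le> 1"
  by (cases t; simp add: post_next_bounds)+

lemma lik_nonneg: "0 \<le> lik k t x"
  by (induction t) (simp_all add: pred_dens_nonneg)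

lemma vpost_cong:
  assumes "\<And>s. 1 \<le> s \<Longrightarrow> s \<le> t \<Longrightarrow> x (k, s) = y (k, s)"
  shows "vpost k t x = vpost k t y"
  using assms by (induction t) simp_all

lemma lik_cong:
  assumes "\<And>s. 1 \<le> s \<Longrightarrow> s \<le> t \<Longrightarrow> x (k, s) = y (k, s)"
  shows "lik k t x = lik k t y"
  using assms
proof (induction t)
  case (Suc t)
  have "vpost k t x = vpost k t y" "lik k t x = lik k t y"
    using Suc by (auto intro: vpost_cong)
  then show ?case using Suc.prems[of "Suc t"] by simp
qed simp

lemma vpost_meas[measurable]:
  assumes "k \<in> {1..K}" "s \<le> t"
  shows "vpost k s \<in> borel_measurable (hist_space t)"
  using assms(2)
proof (induction s)
  case (Suc s)
  then have [measurable]: "vpost k s \<in> borel_measurable (hist_space t)" by simp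
  have "(k, Suc s) \<in> obs_idx t" using Suc.prems assms(1) by (simp add: obs_idx_def)
  then have [measurable]: "(\<lambda>x. x (k, Suc s)) \<in> measurable (hist_space t) \<nu>" by measurable
  have "vpost k (Suc s) = (\<lambda>x. post_next (vpost k s x) (x (k, Suc s)))" by auto
  then show ?case by simp
next
  case 0
  have "vpost k 0 = (\<lambda>x. 0)" by auto
  then show ?case by simp
qed

lemma lik_meas[measurable]:
  assumes "k \<in> {1..K}" "s \<le> t"
  shows "lik k s \<in> borel_measurable (hist_space t)"
  using assms(2)
proof (induction s)
  case (Suc s)
  then have [measurable]: "lik k s \<in> borel_measurable (hist_space t)" by simp
  have [measurable]: "vpost k s \<in> borel_measurable (hist_space t)" using Suc.prems assms by simp
  have "(k, Suc s) \<in> obs_idx t" using Suc.prems assms(1) by (simp add: obs_idx_def)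
  then have [measurable]: "(\<lambda>x. x (k, Suc s)) \<in> measurable (hist_space t) \<nu>" by measurable
  have "lik k (Suc s) = (\<lambda>x. lik k s x * pred_dens (vpost k s x) (x (k, Suc s)))" by auto
  then show ?case by simp
next
  case 0
  have "lik k 0 = (\<lambda>x. 1)" by auto
  then show ?case by simp
qed

text \<open>Prior times likelihood is split at \<open>\<tau> < t\<close>. In the step, every change
  point below \<open>Suc t\<close> lets the new observation follow \<open>q\<close>, and the new
  value \<open>m = t\<close> contributes a share \<theta> of the unchanged mass. That mass is the
  second identity, hence the joint induction.\<close>

lemma lik_split:
  "(\<Sum>m<t. \<theta> * (1 - \<theta>) ^ m * (\<Prod>s=1..t. dens m s (x (k, s)))) = vpost k t x * lik k t x"
  "(1 - \<theta>) ^ t * (\<Prod>s=1..t. p (x (k, s))) = (1 - vpost k t x) * lik k t x"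
proof (induction t)
  case (Suc t)
  let ?y = "x (k, Suc t)" and ?V = "vpost k t x" and ?l = "lik k t x"
  have chg: "chg ?V = ?V + \<theta> * (1 - ?V)" by (rule chg_eq[OF vpost_bounds])
  have new: "vpost k (Suc t) x * lik k (Suc t) x = ?l * (chg ?V * q ?y)"
    using post_next_pred_dens[of ?V ?y] by simp
  have "(\<Sum>m<Suc t. \<theta> * (1 - \<theta>) ^ m * (\<Prod>s=1..Suc t. dens m s (x (k, s))))
      = (\<Sum>m<Suc t. \<theta> * (1 - \<theta>) ^ m * (\<Prod>s=1..t. dens m s (x (k, s)))) * q ?y"
    unfolding sum_distrib_right by (intro sum.cong) (auto simp: dens_def)
  also have "(\<Sum>m<Suc t. \<theta> * (1 - \<theta>) ^ m * (\<Prod>s=1..t. dens m s (x (k, s))))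
      = ?V * ?l + \<theta> * ((1 - \<theta>) ^ t * (\<Prod>s=1..t. p (x (k, s))))"
    using Suc.IH(1) by (simp add: dens_def)
  also have "\<dots> = ?l * chg ?V"
    unfolding Suc.IH(2) chg by (simp add: algebra_simps)
  finally show *: "(\<Sum>m<Suc t. \<theta> * (1 - \<theta>) ^ m * (\<Prod>s=1..Suc t. dens m s (x (k, s)))) = vpost k (Suc t) x * lik k (Suc t) x"
    unfolding new by simp
  have "(1 - \<theta>) ^ Suc t * (\<Prod>s=1..Suc t. p (x (k, s))) = (1 - \<theta>) * ((1 - \<theta>) ^ t * (\<Prod>s=1..t. p (x (k, s)))) * p ?y"
    by simp
  also have "\<dots> = ?l * (1 - chg ?V) * p ?y"
    unfolding Suc.IH(2) chg by (simp add: algebra_simps)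
  also have "\<dots> = lik k (Suc t) x - ?l * (chg ?V * q ?y)"
    by (simp add: pred_dens_def algebra_simps)
  also have "\<dots> = (1 - vpost k (Suc t) x) * lik k (Suc t) x"
    unfolding new[symmetric] by (simp add: algebra_simps)
  finally show "(1 - \<theta>) ^ Suc t * (\<Prod>s=1..Suc t. p (x (k, s))) = (1 - vpost k (Suc t) x) * lik k (Suc t) x" .
qed simp_all

text \<open>For \<open>m \<ge> t\<close> all observations up to \<open>t\<close> follow
  \<open>p\<close>, so the tail is a geometric series; \<open>lik_split\<close> identifies its sum
  and supplies the head.\<close>

lemma lik_sums: "(\<lambda>m. \<theta> * (1 - \<theta>) ^ m * (\<Prod>s=1..t. dens m s (x (k, s)))) sums lik k t x"
proof -
  let ?f = "\<lambda>m. \<theta> * (1 - \<theta>) ^ m * (\<Prod>s=1..t. dens m s (x (k, s)))"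
  have "(\<lambda>m. (1 - \<theta>) ^ m) sums (1 / (1 - (1 - \<theta>)))"
    using theta by (intro geometric_sums) auto
  then have "(\<lambda>m. (\<theta> * (1 - \<theta>) ^ t * (\<Prod>s=1..t. p (x (k, s)))) * (1 - \<theta>) ^ m)
      sums ((\<theta> * (1 - \<theta>) ^ t * (\<Prod>s=1..t. p (x (k, s)))) * (1 / (1 - (1 - \<theta>))))"
    by (rule sums_mult)
  also have "(\<lambda>m. (\<theta> * (1 - \<theta>) ^ t * (\<Prod>s=1..t. p (x (k, s)))) * (1 - \<theta>) ^ m) = (\<lambda>m. ?f (m + t))"
    by (simp add: dens_def power_add mult_ac)
  also have "(\<theta> * (1 - \<theta>) ^ t * (\<Prod>s=1..t. p (x (k, s)))) * (1 / (1 - (1 - \<theta>))) = (1 - vpost k t x) * lik k t x"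
    using theta lik_split(2)[of t x k] by simp
  finally have "?f sums ((1 - vpost k t x) * lik k t x + (\<Sum>m<t. ?f m))"
    by (subst (asm) sums_iff_shift)
  then show ?thesis unfolding lik_split(1) by (simp add: algebra_simps)
qed

text \<open>The joint density of the event \<open>\<tau> k \<in> C\<close> and the first
  \<open>t\<close> observations of stream \<open>k\<close>. The sum is an integral over counting
  measure so that it can be exchanged with integrals and products.\<close>

definition wt :: "nat set \<Rightarrow> nat \<Rightarrow> nat \<Rightarrow> (nat \<times> nat \<Rightarrow> 'x) \<Rightarrow> ennreal" where
  "wt C k t x = (\<integral>\<^sup>+m. ennreal (\<theta> * (1 - \<theta>) ^ m * (\<Prod>s=1..t. dens m s (x (k, s)))) \<partial>count_space C)"

lemma wt_term_nonneg: "0 \<le> \<theta> * (1 - \<theta>) ^ m * (\<Prod>s=1..t. dens m s (x (k, s)))"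
  using theta dens_nonneg by (auto intro!: mult_nonneg_nonneg prod_nonneg)

lemma wt_UNIV: "wt UNIV k t x = ennreal (lik k t x)"
  unfolding wt_def nn_integral_count_space_nat
  by (intro suminf_ennreal_eq wt_term_nonneg lik_sums)

lemma wt_lessThan: "wt {..<t} k t x = ennreal (vpost k t x) * ennreal (lik k t x)"
proof -
  have "wt {..<t} k t x = ennreal (\<Sum>m<t. \<theta> * (1 - \<theta>) ^ m * (\<Prod>s=1..t. dens m s (x (k, s))))"
    unfolding wt_def by (subst nn_integral_count_space_finite, rule finite_lessThan, rule sum_ennreal[OF wt_term_nonneg])
  then show ?thesis unfolding lik_split using vpost_bounds lik_nonneg by (simp add: ennreal_mult)
qed

section \<open>Joint law of change points and history\<close>

text \<open>Both sides are measures in \<open>D\<close>, the left one finite, and they agree on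
  boxes by \<open>joint_law\<close>; boxes are stable under intersection and generate the product
  algebra.\<close>

lemma emeasure_fixed_tau:
  assumes D[measurable]: "D \<in> sets (hist_space t)"
  shows "emeasure M {\<omega> \<in> space M. (\<forall>k\<in>{1..K}. \<tau> k \<omega> = m k) \<and> history t \<omega> \<in> D}
    = (\<integral>\<^sup>+x. (\<Prod>k\<in>{1..K}. ennreal (\<theta> * (1 - \<theta>) ^ m k * (\<Prod>s=1..t. dens (m k) s (x (k, s))))) * indicator D x \<partial>hist_space t)"
proof -
  note [measurable] = tau_meas
  interpret nu: product_sigma_finite "\<lambda>_. \<nu>" by standard
  define E where "E = {\<omega> \<in> space M. \<forall>k\<in>{1..K}. \<tau> k \<omega> = m k}"
  have E[measurable]: "E \<in> sets M" unfolding E_def by measurable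
  let ?L = "\<lambda>x. \<Prod>k\<in>{1..K}. ennreal (\<theta> * (1 - \<theta>) ^ m k * (\<Prod>s=1..t. dens (m k) s (x (k, s))))"
  have [measurable]: "(\<lambda>x. dens (m k) s (x (k, s))) \<in> borel_measurable (hist_space t)" if "k \<in> {1..K}" "s \<in> {1..t}" for k s
  proof -
    have "(k, s) \<in> obs_idx t" using that by (simp add: obs_idx_def)
    then show ?thesis by measurable
  qed
  have L[measurable]: "?L \<in> borel_measurable (hist_space t)" by measurable
  define \<mu>1 where "\<mu>1 = distr (density M (indicator E)) (hist_space t) (history t)"
  define \<mu>2 where "\<mu>2 = density (hist_space t) ?L"
  have \<mu>1: "emeasure \<mu>1 D = emeasure M {\<omega> \<in> space M. (\<forall>k\<in>{1..K}. \<tau> k \<omega> = m k) \<and> history t \<omega> \<in> D}"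
    if [measurable]: "D \<in> sets (hist_space t)" for D
  proof -
    have "emeasure \<mu>1 D = (\<integral>\<^sup>+\<omega>. indicator E \<omega> * indicator (history t -` D \<inter> space M) \<omega> \<partial>M)"
      unfolding \<mu>1_def by (simp add: emeasure_distr emeasure_density)
    also have "\<dots> = (\<integral>\<^sup>+\<omega>. indicator {\<omega> \<in> space M. (\<forall>k\<in>{1..K}. \<tau> k \<omega> = m k) \<and> history t \<omega> \<in> D} \<omega> \<partial>M)"
      by (intro nn_integral_cong) (auto simp: indicator_def E_def)
    also have "\<dots> = emeasure M {\<omega> \<in> space M. (\<forall>k\<in>{1..K}. \<tau> k \<omega> = m k) \<and> history t \<omega> \<in> D}"
      by (intro nn_integral_indicator) measurable
    finally show ?thesis .
  qed
  have "\<mu>1 = \<mu>2"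
  proof (rule measure_eqI_PiM_finite[where I = "obs_idx t" and M = "\<lambda>_. \<nu>" and A = "\<lambda>_. space (hist_space t)"])
    show "finite (obs_idx t)" by simp
    show "sets \<mu>1 = sets (hist_space t)" "sets \<mu>2 = sets (hist_space t)" by (simp_all add: \<mu>1_def \<mu>2_def)
    show "range (\<lambda>_. space (hist_space t)) \<subseteq> prod_algebra (obs_idx t) (\<lambda>_. \<nu>)"
      by (auto simp: space_PiM intro!: prod_algebraI_finite)
    show "(\<Union>i::nat. space (hist_space t)) = space (hist_space t)" by simp
    show "emeasure \<mu>1 (space (hist_space t)) \<noteq> \<infinity>" by (simp add: \<mu>1 M.emeasure_finite)
    fix B :: "nat \<times> nat \<Rightarrow> 'x set" assume B[measurable]: "\<And>j. j \<in> obs_idx t \<Longrightarrow> B j \<in> sets \<nu>"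
    have PiEB[measurable]: "PiE (obs_idx t) B \<in> sets (hist_space t)" by (intro sets_PiM_I_finite) auto
    let ?P = "\<lambda>j. density \<nu> (\<lambda>x. ennreal (dens (m (fst j)) (snd j) x))"
    have "emeasure \<mu>1 (PiE (obs_idx t) B)
      = emeasure M {\<omega> \<in> space M. (\<forall>k\<in>{1..K}. \<tau> k \<omega> = m k) \<and> (\<forall>(k, s)\<in>obs_idx t. X k s \<omega> \<in> B (k, s))}"
      by (subst \<mu>1[OF PiEB]) (auto simp: history_def Pi_iff intro!: arg_cong[of _ _ "emeasure M"])
    also have "\<dots> = ennreal ((\<Prod>k\<in>{1..K}. \<theta> * (1 - \<theta>) ^ m k) * (\<Prod>j\<in>obs_idx t. measure (?P j) (B j)))"
      using joint_law[of "obs_idx t" B m] B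
      by (simp add: M.emeasure_eq_measure obs_idx_def dens_def case_prod_unfold subset_iff)
    also have "\<dots> = ennreal (\<Prod>k\<in>{1..K}. \<theta> * (1 - \<theta>) ^ m k) * (\<Prod>j\<in>obs_idx t. ennreal (measure (?P j) (B j)))"
      using theta by (subst ennreal_mult) (auto intro!: prod_nonneg simp: prod_ennreal)
    also have "(\<Prod>j\<in>obs_idx t. ennreal (measure (?P j) (B j)))
        = (\<Prod>j\<in>obs_idx t. \<integral>\<^sup>+x. ennreal (dens (m (fst j)) (snd j) x) * indicator (B j) x \<partial>\<nu>)"
    proof (intro prod.cong refl)
      fix j assume j[simp]: "j \<in> obs_idx t"
      have "(\<integral>\<^sup>+x. ennreal (dens (m (fst j)) (snd j) x) * indicator (space \<nu>) x \<partial>\<nu>) = 1"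
        using dens_int[of "m (fst j)" "snd j"] by (simp add: dens_int cong: nn_integral_cong_simp)
      then interpret P: prob_space "?P j"
        by (intro prob_spaceI) (simp add: emeasure_density)
      show "ennreal (measure (?P j) (B j)) = (\<integral>\<^sup>+x. ennreal (dens (m (fst j)) (snd j) x) * indicator (B j) x \<partial>\<nu>)"
        by (simp add: P.emeasure_eq_measure[symmetric] emeasure_density)
    qed
    also have "\<dots> = (\<integral>\<^sup>+x. (\<Prod>j\<in>obs_idx t. ennreal (dens (m (fst j)) (snd j) (x j)) * indicator (B j) (x j)) \<partial>hist_space t)"
      by (intro nu.product_nn_integral_prod[symmetric]) auto
    also have "ennreal (\<Prod>k\<in>{1..K}. \<theta> * (1 - \<theta>) ^ m k) * \<dots>
       = (\<integral>\<^sup>+x. ennreal (\<Prod>k\<in>{1..K}. \<theta> * (1 - \<theta>) ^ m k) * (\<Prod>j\<in>obs_idx t. ennreal (dens (m (fst j)) (snd j) (x j)) * indicator (B j) (x j)) \<partial>hist_space t)"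
      by (intro nn_integral_cmult[symmetric]) measurable
    also have "\<dots> = (\<integral>\<^sup>+x. ?L x * indicator (PiE (obs_idx t) B) x \<partial>hist_space t)"
    proof (intro nn_integral_cong)
      fix x assume "x \<in> space (hist_space t)"
      then have "indicator (PiE (obs_idx t) B) x = (\<Prod>j\<in>obs_idx t. indicator (B j) (x j) :: ennreal)"
        by (auto simp: indicator_def PiE_iff prod_zero_iff space_PiM)
      moreover have "?L x = ennreal (\<Prod>k\<in>{1..K}. \<theta> * (1 - \<theta>) ^ m k) * (\<Prod>j\<in>obs_idx t. ennreal (dens (m (fst j)) (snd j) (x j)))"
        using theta dens_nonneg
        by (simp add: ennreal_mult prod_nonneg prod.distrib ennreal_power[symmetric] prod_ennreal[symmetric] obs_idx_def prod.cartesian_product case_prod_unfold)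
      ultimately show "ennreal (\<Prod>k\<in>{1..K}. \<theta> * (1 - \<theta>) ^ m k) * (\<Prod>j\<in>obs_idx t. ennreal (dens (m (fst j)) (snd j) (x j)) * indicator (B j) (x j))
         = ?L x * indicator (PiE (obs_idx t) B) x"
        by (simp add: prod.distrib mult.assoc)
    qed
    also have "\<dots> = emeasure \<mu>2 (PiE (obs_idx t) B)"
      unfolding \<mu>2_def by (simp add: emeasure_density)
    finally show "emeasure \<mu>1 (PiE (obs_idx t) B) = emeasure \<mu>2 (PiE (obs_idx t) B)" .
  qed
  then have "emeasure \<mu>1 D = emeasure \<mu>2 D" by simp
  then show ?thesis unfolding \<mu>1[OF D] by (simp add: \<mu>2_def emeasure_density)
qed

text \<open>Countably many configurations of change points on \<open>1..K\<close> partition the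
  event. Summation and integration are exchanged, and the sum of products factors into one weight
  per stream.\<close>

lemma emeasure_tau_in:
  assumes D[measurable]: "D \<in> sets (hist_space t)"
  shows "emeasure M {\<omega> \<in> space M. (\<forall>k\<in>{1..K}. \<tau> k \<omega> \<in> C k) \<and> history t \<omega> \<in> D}
    = (\<integral>\<^sup>+x. (\<Prod>k\<in>{1..K}. wt (C k) k t x) * indicator D x \<partial>hist_space t)"
proof -
  note [measurable] = tau_meas
  let ?E = "\<lambda>m. {\<omega> \<in> space M. (\<forall>k\<in>{1..K}. \<tau> k \<omega> = m k) \<and> history t \<omega> \<in> D}"
  let ?f = "\<lambda>x k m. ennreal (\<theta> * (1 - \<theta>) ^ m * (\<Prod>s=1..t. dens m s (x (k, s))))"
  have cnt: "countable (PiE {1..K} C)" by (intro countable_PiE) auto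
  have [measurable]: "(\<lambda>x. dens m s (x (k, s))) \<in> borel_measurable (hist_space t)" if "k \<in> {1..K}" "s \<in> {1..t}" for k s m
  proof -
    have "(k, s) \<in> obs_idx t" using that by (simp add: obs_idx_def)
    then show ?thesis by measurable
  qed
  have "{\<omega> \<in> space M. (\<forall>k\<in>{1..K}. \<tau> k \<omega> \<in> C k) \<and> history t \<omega> \<in> D} = (\<Union>m\<in>PiE {1..K} C. ?E m)"
  proof
    show "{\<omega> \<in> space M. (\<forall>k\<in>{1..K}. \<tau> k \<omega> \<in> C k) \<and> history t \<omega> \<in> D} \<subseteq> (\<Union>m\<in>PiE {1..K} C. ?E m)"
    proof
      fix \<omega> assume "\<omega> \<in> {\<omega> \<in> space M. (\<forall>k\<in>{1..K}. \<tau> k \<omega> \<in> C k) \<and> history t \<omega> \<in> D}"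
      then show "\<omega> \<in> (\<Union>m\<in>PiE {1..K} C. ?E m)"
        by (intro UN_I[of "\<lambda>k\<in>{1..K}. \<tau> k \<omega>"]) auto
    qed
  qed (auto simp: PiE_iff)
  also have "emeasure M \<dots> = (\<integral>\<^sup>+m. emeasure M (?E m) \<partial>count_space (PiE {1..K} C))"
  proof (intro emeasure_UN_countable cnt)
    show "?E m \<in> sets M" for m by measurable
    show "disjoint_family_on ?E (PiE {1..K} C)"
      unfolding disjoint_family_on_def
    proof (intro ballI impI)
      fix m n assume mn: "m \<in> PiE {1..K} C" "n \<in> PiE {1..K} C" "m \<noteq> n"
      then obtain k where "k \<in> {1..K}" "m k \<noteq> n k" by (metis PiE_ext)
      then show "?E m \<inter> ?E n = {}" by force
    qed
  qed
  also have "\<dots> = (\<integral>\<^sup>+m. (\<integral>\<^sup>+x. (\<Prod>k\<in>{1..K}. ?f x k (m k)) * indicator D x \<partial>hist_space t) \<partial>count_space (PiE {1..K} C))"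
    by (simp only: emeasure_fixed_tau[OF D])
  also have "\<dots> = (\<integral>\<^sup>+x. (\<integral>\<^sup>+m. (\<Prod>k\<in>{1..K}. ?f x k (m k)) * indicator D x \<partial>count_space (PiE {1..K} C)) \<partial>hist_space t)"
    by (intro nn_integral_count_space_nn_integral[symmetric] cnt) measurable
  also have "\<dots> = (\<integral>\<^sup>+x. (\<Prod>k\<in>{1..K}. wt (C k) k t x) * indicator D x \<partial>hist_space t)"
  proof (intro nn_integral_cong)
    fix x
    show "(\<integral>\<^sup>+m. (\<Prod>k\<in>{1..K}. ?f x k (m k)) * indicator D x \<partial>count_space (PiE {1..K} C)) = (\<Prod>k\<in>{1..K}. wt (C k) k t x) * indicator D x"
      unfolding wt_def
      using nn_integral_count_space_PiE[of "{1..K}" C "?f x"] by (simp add: nn_integral_multc)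
  qed
  finally show ?thesis .
qed

definition lik_all :: "nat \<Rightarrow> (nat \<times> nat \<Rightarrow> 'x) \<Rightarrow> ennreal" where
  "lik_all t x = (\<Prod>k\<in>{1..K}. ennreal (lik k t x))"

lemma lik_all_meas[measurable]: "lik_all t \<in> borel_measurable (hist_space t)"
  unfolding lik_all_def by measurable

lemma distr_history: "distr M (hist_space t) (history t) = density (hist_space t) (lik_all t)"
proof (rule measure_eqI)
  fix D assume "D \<in> sets (distr M (hist_space t) (history t))"
  then have [measurable]: "D \<in> sets (hist_space t)" by simp
  show "emeasure (distr M (hist_space t) (history t)) D = emeasure (density (hist_space t) (lik_all t)) D"
    using emeasure_tau_in[of D t "\<lambda>_. UNIV"]
    by (simp add: emeasure_distr emeasure_density wt_UNIV lik_all_def vimage_def Int_def conj_commute)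
qed simp

lemma nn_integral_history:
  assumes [measurable]: "F \<in> borel_measurable (hist_space t)"
  shows "(\<integral>\<^sup>+\<omega>. F (history t \<omega>) \<partial>M) = (\<integral>\<^sup>+x. lik_all t x * F x \<partial>hist_space t)"
proof -
  have "(\<integral>\<^sup>+\<omega>. F (history t \<omega>) \<partial>M) = (\<integral>\<^sup>+x. F x \<partial>distr M (hist_space t) (history t))"
    by (simp add: nn_integral_distr)
  then show ?thesis unfolding distr_history by (simp add: nn_integral_density)
qed

text \<open>Only the factor of stream \<open>k\<close> in the joint density is altered, and
  \<open>wt_lessThan\<close> turns it into posterior times likelihood. So even given the records of
  all streams, the posterior of \<open>\<tau> k < t\<close> is computed from stream \<open>k\<close>
  alone.\<close>

lemma emeasure_change_before:
  assumes k: "k \<in> {1..K}" and D[measurable]: "D \<in> sets (hist_space t)"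
  shows "emeasure M {\<omega> \<in> space M. \<tau> k \<omega> < t \<and> history t \<omega> \<in> D}
    = (\<integral>\<^sup>+\<omega>. ennreal (vpost k t (history t \<omega>)) * indicator D (history t \<omega>) \<partial>M)"
proof -
  define C where "C j = (if j = k then {..<t} else UNIV)" for j
  note [measurable] = vpost_meas[OF k order_refl]
  have *: "(\<Prod>j\<in>{1..K}. wt (C j) j t x) = lik_all t x * ennreal (vpost k t x)" for x
  proof -
    have "(\<Prod>j\<in>{1..K}. wt (C j) j t x) = (\<Prod>j\<in>{1..K}. ennreal (lik j t x) * (if j = k then ennreal (vpost k t x) else 1))"
      by (intro prod.cong) (auto simp: C_def wt_UNIV wt_lessThan mult.commute)
    also have "\<dots> = lik_all t x * ennreal (vpost k t x)"
      using k by (simp add: prod.distrib lik_all_def)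
    finally show ?thesis .
  qed
  have "{\<omega> \<in> space M. \<tau> k \<omega> < t \<and> history t \<omega> \<in> D} = {\<omega> \<in> space M. (\<forall>j\<in>{1..K}. \<tau> j \<omega> \<in> C j) \<and> history t \<omega> \<in> D}"
    using k by (auto simp: C_def)
  then have "emeasure M {\<omega> \<in> space M. \<tau> k \<omega> < t \<and> history t \<omega> \<in> D}
      = (\<integral>\<^sup>+x. lik_all t x * (ennreal (vpost k t x) * indicator D x) \<partial>hist_space t)"
    by (simp only: emeasure_tau_in[OF D] * mult.assoc)
  also have "\<dots> = (\<integral>\<^sup>+\<omega>. ennreal (vpost k t (history t \<omega>)) * indicator D (history t \<omega>) \<partial>M)"
    by (intro nn_integral_history[symmetric]) measurable
  finally show ?thesis .
qed

section \<open>Markov property of the posteriors\<close>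

text \<open>The density of the longer history is that of the shorter one times a product of
  predictive densities, in which the past enters only through the current posteriors. Integrating
  out the observations of time \<open>Suc t\<close> therefore produces the kernels. As
  \<open>D\<close> is an arbitrary event of the past, this is a conditional expectation in
  integrated form.\<close>

lemma markov_step:
  assumes A: "A \<subseteq> {1..K}" and D[measurable]: "D \<in> sets (hist_space t)"
    and F[measurable]: "F \<in> borel_measurable (PiM A (\<lambda>_. borel))"
  shows "(\<integral>\<^sup>+\<omega>. indicator D (history t \<omega>) * F (\<lambda>k\<in>A. vpost k (Suc t) (history (Suc t) \<omega>)) \<partial>M)
    = (\<integral>\<^sup>+\<omega>. indicator D (history t \<omega>) * (\<integral>\<^sup>+y. F y \<partial>PiM A (\<lambda>k. kern (vpost k t (history t \<omega>)))) \<partial>M)"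
proof -
  interpret nu: product_sigma_finite "\<lambda>_. \<nu>" by standard
  define N where "N = {1..K} \<times> {Suc t}"
  have finA: "finite A" using A finite_subset by auto
  have finN: "finite N" by (simp add: N_def)
  have J: "obs_idx (Suc t) = obs_idx t \<union> N" "obs_idx t \<inter> N = {}"
    by (auto simp: obs_idx_def N_def)
  have [measurable]: "(\<lambda>x. restrict x (obs_idx t)) \<in> measurable (hist_space (Suc t)) (hist_space t)"
    unfolding J by (intro measurable_restrict_subset) auto
  note [measurable] = vpost_meas
  have vA[measurable]: "(\<lambda>x. \<lambda>k\<in>A. vpost k (Suc t) x) \<in> measurable (hist_space (Suc t)) (PiM A (\<lambda>_. borel))"
    using A by (intro measurable_restrict vpost_meas) auto
  define G where "G x = indicator D (restrict x (obs_idx t)) * F (\<lambda>k\<in>A. vpost k (Suc t) x)" for x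
  have G[measurable]: "G \<in> borel_measurable (hist_space (Suc t))" unfolding G_def by measurable
  have G'[measurable]: "(\<lambda>x. lik_all (Suc t) x * G x) \<in> borel_measurable (PiM (obs_idx t \<union> N) (\<lambda>_. \<nu>))"
    unfolding J(1)[symmetric] by measurable
  have res: "restrict (history (Suc t) \<omega>) (obs_idx t) = history t \<omega>" for \<omega>
    unfolding history_def J by auto
  define \<Phi> where "\<Phi> x = (\<integral>\<^sup>+y. F y \<partial>PiM A (\<lambda>k. kern (vpost k t x)))" for x
  have \<Phi>[measurable]: "\<Phi> \<in> borel_measurable (hist_space t)"
    unfolding \<Phi>_def using A by (intro measurable_nn_integral_PiM_kern finA F vpost_meas) auto
  have inner: "(\<integral>\<^sup>+y. lik_all (Suc t) (merge (obs_idx t) N (x, y)) * G (merge (obs_idx t) N (x, y)) \<partial>PiM N (\<lambda>_. \<nu>))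
      = lik_all t x * (indicator D x * \<Phi> x)" if x: "x \<in> space (hist_space t)" for x
  proof -
    let ?V = "\<lambda>k. vpost k t x"
    define H where "H z = (\<Prod>k\<in>{1..K}. ennreal (pred_dens (?V k) (z k))) * F (\<lambda>k\<in>A. post_next (?V k) (z k))" for z
    have [measurable]: "(\<lambda>z. \<lambda>k\<in>A. post_next (?V k) (z k)) \<in> measurable (PiM {1..K} (\<lambda>_. \<nu>)) (PiM A (\<lambda>_. borel))"
      using A by (intro measurable_restrict post_next_meas measurable_component_singleton) auto
    have H[measurable]: "H \<in> borel_measurable (PiM {1..K} (\<lambda>_. \<nu>))" unfolding H_def by measurable
    have V: "vpost k t (merge (obs_idx t) N (x, y)) = ?V k" "lik k t (merge (obs_idx t) N (x, y)) = lik k t x"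
      if "k \<in> {1..K}" for k y
      using that by (auto intro!: vpost_cong lik_cong simp: merge_def obs_idx_def)
    have new: "merge (obs_idx t) N (x, y) (k, Suc t) = y (k, Suc t)" if "k \<in> {1..K}" for k y
      using that by (simp add: merge_def obs_idx_def N_def)
    have xr: "restrict (merge (obs_idx t) N (x, y)) (obs_idx t) = x" for y
      using x J(2) by (auto simp: space_PiM merge_def restrict_def PiE_def extensional_def)
    have eq: "lik_all (Suc t) (merge (obs_idx t) N (x, y)) * G (merge (obs_idx t) N (x, y))
        = (lik_all t x * indicator D x) * H (\<lambda>k\<in>{1..K}. y (k, Suc t))" for y
    proof -
      have "lik_all (Suc t) (merge (obs_idx t) N (x, y)) = lik_all t x * (\<Prod>k\<in>{1..K}. ennreal (pred_dens (?V k) (y (k, Suc t))))"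
        unfolding lik_all_def by (simp add: V new ennreal_mult lik_nonneg pred_dens_nonneg prod.distrib)
      moreover have "(\<lambda>k\<in>A. vpost k (Suc t) (merge (obs_idx t) N (x, y))) = (\<lambda>k\<in>A. post_next (?V k) ((\<lambda>k\<in>{1..K}. y (k, Suc t)) k))"
        using A by (intro restrict_ext) (auto simp: V new subset_iff)
      ultimately show ?thesis by (simp add: G_def H_def xr mult_ac)
    qed
    have "(\<integral>\<^sup>+y. H (\<lambda>k\<in>{1..K}. y (k, Suc t)) \<partial>PiM N (\<lambda>_. \<nu>)) = (\<integral>\<^sup>+z. H z \<partial>PiM {1..K} (\<lambda>_. \<nu>))"
    proof -
      have "(\<integral>\<^sup>+z. H z \<partial>PiM {1..K} (\<lambda>_. \<nu>)) = (\<integral>\<^sup>+z. H z \<partial>distr (PiM N (\<lambda>_. \<nu>)) (PiM {1..K} (\<lambda>_. \<nu>)) (\<lambda>y. \<lambda>k\<in>{1..K}. y (k, Suc t)))"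
        using distr_PiM_reindex[of N "\<lambda>_. \<nu>" "\<lambda>k. (k, Suc t)" "{1..K}"] prob_space_axioms
        by (auto simp: N_def inj_on_def)
      also have "\<dots> = (\<integral>\<^sup>+y. H (\<lambda>k\<in>{1..K}. y (k, Suc t)) \<partial>PiM N (\<lambda>_. \<nu>))"
      proof (intro nn_integral_distr)
        show "(\<lambda>y. \<lambda>k\<in>{1..K}. y (k, Suc t)) \<in> measurable (PiM N (\<lambda>_. \<nu>)) (PiM {1..K} (\<lambda>_. \<nu>))"
          by (intro measurable_restrict measurable_component_singleton) (auto simp: N_def)
      qed (use H in simp)
      finally show ?thesis by simp
    qed
    \<comment> \<open>The streams outside \<open>A\<close> are marginalized: their kernels have mass
      one.\<close>
    also have "\<dots> = \<Phi> x"
    proof -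
      have [measurable]: "(\<lambda>y. restrict y A) \<in> measurable (PiM {1..K} (\<lambda>_. borel)) (PiM A (\<lambda>_. borel :: real measure))"
        by (intro measurable_restrict_subset A)
      have r: "(\<lambda>k\<in>A. post_next (?V k) (z k)) = restrict (\<lambda>k\<in>{1..K}. post_next (?V k) (z k)) A" for z
        using A by (auto simp: restrict_def fun_eq_iff)
      have "(\<integral>\<^sup>+z. H z \<partial>PiM {1..K} (\<lambda>_. \<nu>)) = (\<integral>\<^sup>+y. F (restrict y A) \<partial>PiM {1..K} (\<lambda>k. kern (?V k)))"
        unfolding H_def r by (intro nn_integral_PiM_kern[symmetric] finite_atLeastAtMost) measurable
      also have "\<dots> = (\<integral>\<^sup>+y. F y \<partial>distr (PiM {1..K} (\<lambda>k. kern (?V k))) (PiM A (\<lambda>k. kern (?V k))) (\<lambda>y. restrict y A))"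
        using F by (intro nn_integral_distr[symmetric] measurable_restrict_subset A) (simp cong: sets_PiM_cong measurable_cong_sets)
      also have "distr (PiM {1..K} (\<lambda>k. kern (?V k))) (PiM A (\<lambda>k. kern (?V k))) (\<lambda>y. restrict y A) = PiM A (\<lambda>k. kern (?V k))"
        using distr_PiM_reindex[of "{1..K}" "\<lambda>k. kern (?V k)" "\<lambda>k. k" A] A prob_space_kern by (auto simp: restrict_def)
      finally show ?thesis by (simp add: \<Phi>_def)
    qed
    finally have H\<Phi>: "(\<integral>\<^sup>+y. H (\<lambda>k\<in>{1..K}. y (k, Suc t)) \<partial>PiM N (\<lambda>_. \<nu>)) = \<Phi> x" .
    have HN: "(\<lambda>y. H (\<lambda>k\<in>{1..K}. y (k, Suc t))) \<in> borel_measurable (PiM N (\<lambda>_. \<nu>))"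
      by (rule measurable_compose[OF _ H], intro measurable_restrict measurable_component_singleton) (auto simp: N_def)
    show ?thesis unfolding eq nn_integral_cmult[OF HN] H\<Phi> by (rule mult.assoc)
  qed
  have "(\<integral>\<^sup>+\<omega>. indicator D (history t \<omega>) * F (\<lambda>k\<in>A. vpost k (Suc t) (history (Suc t) \<omega>)) \<partial>M)
     = (\<integral>\<^sup>+\<omega>. G (history (Suc t) \<omega>) \<partial>M)"
    by (simp add: G_def res)
  also have "\<dots> = (\<integral>\<^sup>+x. lik_all (Suc t) x * G x \<partial>hist_space (Suc t))"
    by (rule nn_integral_history[OF G])
  also have "\<dots> = (\<integral>\<^sup>+x. (\<integral>\<^sup>+y. lik_all (Suc t) (merge (obs_idx t) N (x, y)) * G (merge (obs_idx t) N (x, y)) \<partial>PiM N (\<lambda>_. \<nu>)) \<partial>hist_space t)"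
    unfolding J(1) by (intro nu.product_nn_integral_fold J(2) finN finite_obs_idx G')
  also have "\<dots> = (\<integral>\<^sup>+x. lik_all t x * (indicator D x * \<Phi> x) \<partial>hist_space t)"
    by (intro nn_integral_cong inner)
  also have "\<dots> = (\<integral>\<^sup>+\<omega>. indicator D (history t \<omega>) * \<Phi> (history t \<omega>) \<partial>M)"
    by (intro nn_integral_history[symmetric]) measurable
  finally show ?thesis unfolding \<Phi>_def .
qed

text \<open>Evaluated at the unrestricted array of observations, so that the recursion in
  \<open>t\<close> holds by definition and one function serves all times.\<close>

definition V :: "nat \<Rightarrow> nat \<Rightarrow> 'w \<Rightarrow> real" where
  "V k t \<omega> = vpost k t (\<lambda>j. X (fst j) (snd j) \<omega>)"

lemma vpost_history: "k \<in> {1..K} \<Longrightarrow> vpost k t (history t \<omega>) = V k t \<omega>"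
  unfolding V_def by (rule vpost_cong) (simp add: history_def obs_idx_def)

lemma V_bounds: "0 \<le> V k t \<omega>" "V k t \<omega> \<le> 1"
  unfolding V_def by (rule vpost_bounds)+

lemma V_meas: "k \<in> {1..K} \<Longrightarrow> V k t \<in> borel_measurable M"
  using measurable_compose[OF history_meas vpost_meas[OF _ order_refl]] by (simp add: vpost_history del: atLeastAtMost_iff)

end

section \<open>Dynamic programming\<close>

text \<open>Only determination of the next set by the full history is required, a weaker demand than
  measurability with respect to what the procedure has seen. It is stated by preimages, the form in
  which \<open>markov_step\<close> takes its event \<open>D\<close>.\<close>

locale adapted_sets = change_model \<nu> p q \<theta> M K \<tau> X
  for \<nu> :: "'x measure" and p q :: "'x \<Rightarrow> real" and \<theta> :: real and M :: "'w measure"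
    and K :: nat and \<tau> :: "nat \<Rightarrow> 'w \<Rightarrow> nat" and X :: "nat \<Rightarrow> nat \<Rightarrow> 'w \<Rightarrow> 'x" +
  fixes S :: "nat \<Rightarrow> 'w \<Rightarrow> nat set"
  assumes S_1: "\<And>\<omega>. \<omega> \<in> space M \<Longrightarrow> S 1 \<omega> = {1..K}"
    and S_Suc: "\<And>t \<omega>. 1 \<le> t \<Longrightarrow> \<omega> \<in> space M \<Longrightarrow> S (Suc t) \<omega> \<subseteq> S t \<omega>"
    and S_adapted: "\<And>t A. 1 \<le> t \<Longrightarrow> \<exists>D\<in>sets (hist_space t). {\<omega> \<in> space M. S (Suc t) \<omega> = A} = history t -` D \<inter> space M"
begin

lemma S_subset: "1 \<le> t \<Longrightarrow> \<omega> \<in> space M \<Longrightarrow> S t \<omega> \<subseteq> {1..K}"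
proof (induction t rule: dec_induct)
  case base
  then show ?case using S_1 by simp
next
  case (step t)
  then show ?case using S_Suc by blast
qed

lemma S_finite: "1 \<le> t \<Longrightarrow> \<omega> \<in> space M \<Longrightarrow> finite (S t \<omega>)"
  by (rule finite_subset[OF S_subset]) auto

lemma S_meas: "1 \<le> t \<Longrightarrow> S t \<in> measurable M (count_space (Pow {1..K}))"
proof (subst measurable_count_space_eq2, simp, intro conjI ballI)
  assume t: "1 \<le> t"
  show "S t \<in> space M \<rightarrow> Pow {1..K}" using S_subset[OF t] by auto
  fix A
  have "{\<omega> \<in> space M. S t \<omega> = A} \<in> sets M"
  proof (cases "t = 1")
    case True
    then have "{\<omega> \<in> space M. S t \<omega> = A} = (if A = {1..K} then space M else {})" using S_1 by auto
    then show ?thesis by simp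
  next
    case False
    then obtain s where s: "t = Suc s" "1 \<le> s" using t by (cases t) auto
    obtain D where D: "D \<in> sets (hist_space s)" "{\<omega> \<in> space M. S (Suc s) \<omega> = A} = history s -` D \<inter> space M"
      using S_adapted[OF s(2), of A] by (elim bexE) (rule that)
    show ?thesis unfolding s(1) D(2) by (rule measurable_sets[OF history_meas D(1)])
  qed
  moreover have "S t -` {A} \<inter> space M = {\<omega> \<in> space M. S t \<omega> = A}" by auto
  ultimately show "S t -` {A} \<inter> space M \<in> sets M" by (simp only:)
qed

lemma measurable_S:
  assumes "1 \<le> t" "\<And>A. A \<subseteq> {1..K} \<Longrightarrow> f A \<in> measurable M N"
  shows "(\<lambda>\<omega>. f (S t \<omega>) \<omega>) \<in> measurable M N"
  by (rule measurable_compose_countable'[OF _ S_meas[OF assms(1)]]) (use assms in \<open>auto intro: countable_finite\<close>)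

lemma card_S_meas[measurable]: "1 \<le> t \<Longrightarrow> (\<lambda>\<omega>. of_nat (card (S t \<omega>)) :: ennreal) \<in> borel_measurable M"
  by (rule measurable_S[where f = "\<lambda>A _. of_nat (card A)"]) auto

lemma kern_S_meas:
  assumes "1 \<le> t" "0 \<le> \<alpha>"
  shows "(\<lambda>\<omega>. \<integral>\<^sup>+y. gval \<alpha> m (S t \<omega>) y \<partial>PiM (S t \<omega>) (\<lambda>k. kern (V k s \<omega>))) \<in> borel_measurable M"
proof (rule measurable_S[OF assms(1)])
  fix A assume A: "A \<subseteq> {1..K}"
  then have "finite A" using finite_subset by auto
  then show "(\<lambda>\<omega>. \<integral>\<^sup>+y. gval \<alpha> m A y \<partial>PiM A (\<lambda>k. kern (V k s \<omega>))) \<in> borel_measurable M"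
    using A assms(2) by (intro measurable_nn_integral_PiM_kern gval_meas_PiM V_meas) auto
qed

text \<open>\<open>markov_step\<close> is for a fixed set \<open>A\<close>, whereas
  \<open>S (Suc t)\<close> is random. It takes finitely many values, and each event
  \<open>S (Suc t) \<omega> = A\<close> belongs to the history up to \<open>t\<close>, so the
  integral splits into terms with fixed \<open>A\<close>.\<close>

lemma nn_integral_gval_next:
  assumes t: "1 \<le> t" and \<alpha>: "0 \<le> \<alpha>"
  shows "(\<integral>\<^sup>+\<omega>. gval \<alpha> m (S (Suc t) \<omega>) (\<lambda>k. V k (Suc t) \<omega>) \<partial>M)
    = (\<integral>\<^sup>+\<omega>. (\<integral>\<^sup>+y. gval \<alpha> m (S (Suc t) \<omega>) y \<partial>PiM (S (Suc t) \<omega>) (\<lambda>k. kern (V k t \<omega>))) \<partial>M)"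
proof -
  obtain D where D[measurable]: "\<And>A. D A \<in> sets (hist_space t)"
    and SD: "\<And>A. {\<omega> \<in> space M. S (Suc t) \<omega> = A} = history t -` D A \<inter> space M"
    using S_adapted[OF t] by metis
  have ind: "indicator (D A) (history t \<omega>) = (if S (Suc t) \<omega> = A then 1 else 0 :: ennreal)" if "\<omega> \<in> space M" for \<omega> A
    using SD[of A] that by (auto simp: indicator_def)
  have sum: "g (S (Suc t) \<omega>) = (\<Sum>A\<in>Pow {1..K}. indicator (D A) (history t \<omega>) * g A)" if "\<omega> \<in> space M" for g :: "nat set \<Rightarrow> ennreal" and \<omega>
  proof -
    have "S (Suc t) \<omega> \<in> Pow {1..K}" using S_subset[of "Suc t" \<omega>] that by simp
    then show ?thesis using that by (simp add: ind if_distrib[of "\<lambda>x. x * _"] sum.delta' cong: if_cong)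
  qed
  have fin: "finite A" if "A \<in> Pow {1..K}" for A using that finite_subset by auto
  note [measurable] = vpost_meas[OF _ order_refl]
  have m1: "(\<lambda>\<omega>. indicator (D A) (history t \<omega>) * gval \<alpha> m A (\<lambda>k\<in>A. vpost k (Suc t) (history (Suc t) \<omega>))) \<in> borel_measurable M"
    if A: "A \<in> Pow {1..K}" for A
  proof -
    have [measurable]: "gval \<alpha> m A \<in> borel_measurable (PiM A (\<lambda>_. borel))" by (intro gval_meas_PiM fin A \<alpha>)
    have [measurable]: "(\<lambda>x. \<lambda>k\<in>A. vpost k (Suc t) x) \<in> measurable (hist_space (Suc t)) (PiM A (\<lambda>_. borel))"
      using A by (intro measurable_restrict vpost_meas) auto
    show ?thesis by measurable
  qed
  have m2: "(\<lambda>\<omega>. indicator (D A) (history t \<omega>) * (\<integral>\<^sup>+y. gval \<alpha> m A y \<partial>PiM A (\<lambda>k. kern (V k t \<omega>)))) \<in> borel_measurable M"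
    if A: "A \<in> Pow {1..K}" for A
  proof -
    have [measurable]: "(\<lambda>\<omega>. \<integral>\<^sup>+y. gval \<alpha> m A y \<partial>PiM A (\<lambda>k. kern (V k t \<omega>))) \<in> borel_measurable M"
      using A by (intro measurable_nn_integral_PiM_kern fin gval_meas_PiM \<alpha> V_meas) auto
    show ?thesis by measurable
  qed
  have "(\<integral>\<^sup>+\<omega>. gval \<alpha> m (S (Suc t) \<omega>) (\<lambda>k. V k (Suc t) \<omega>) \<partial>M)
      = (\<integral>\<^sup>+\<omega>. (\<Sum>A\<in>Pow {1..K}. indicator (D A) (history t \<omega>) * gval \<alpha> m A (\<lambda>k\<in>A. vpost k (Suc t) (history (Suc t) \<omega>))) \<partial>M)"
  proof (intro nn_integral_cong)
    fix \<omega> assume \<omega>: "\<omega> \<in> space M"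
    have "gval \<alpha> m A (\<lambda>k. V k (Suc t) \<omega>) = gval \<alpha> m A (\<lambda>k\<in>A. vpost k (Suc t) (history (Suc t) \<omega>))" if "A \<in> Pow {1..K}" for A
      using that by (intro gval_cong fin \<alpha>) (auto simp: vpost_history subset_iff simp del: vpost.simps)
    then show "gval \<alpha> m (S (Suc t) \<omega>) (\<lambda>k. V k (Suc t) \<omega>)
        = (\<Sum>A\<in>Pow {1..K}. indicator (D A) (history t \<omega>) * gval \<alpha> m A (\<lambda>k\<in>A. vpost k (Suc t) (history (Suc t) \<omega>)))"
      by (subst sum[OF \<omega>]) (intro sum.cong refl, simp only:)
  qed
  also have "\<dots> = (\<Sum>A\<in>Pow {1..K}. \<integral>\<^sup>+\<omega>. indicator (D A) (history t \<omega>) * gval \<alpha> m A (\<lambda>k\<in>A. vpost k (Suc t) (history (Suc t) \<omega>)) \<partial>M)"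
    by (intro nn_integral_sum m1)
  also have "\<dots> = (\<Sum>A\<in>Pow {1..K}. \<integral>\<^sup>+\<omega>. indicator (D A) (history t \<omega>) * (\<integral>\<^sup>+y. gval \<alpha> m A y \<partial>PiM A (\<lambda>k. kern (V k t \<omega>))) \<partial>M)"
  proof (intro sum.cong refl)
    fix A assume A: "A \<in> Pow {1..K}"
    have "PiM A (\<lambda>k. kern (vpost k t (history t \<omega>))) = PiM A (\<lambda>k. kern (V k t \<omega>))" for \<omega>
      using A by (intro PiM_cong refl) (auto simp: vpost_history subset_iff)
    then show "(\<integral>\<^sup>+\<omega>. indicator (D A) (history t \<omega>) * gval \<alpha> m A (\<lambda>k\<in>A. vpost k (Suc t) (history (Suc t) \<omega>)) \<partial>M)
        = (\<integral>\<^sup>+\<omega>. indicator (D A) (history t \<omega>) * (\<integral>\<^sup>+y. gval \<alpha> m A y \<partial>PiM A (\<lambda>k. kern (V k t \<omega>))) \<partial>M)"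
      using markov_step[of A "D A" t "gval \<alpha> m A"] A fin gval_meas_PiM \<alpha> by simp
  qed
  also have "\<dots> = (\<integral>\<^sup>+\<omega>. (\<Sum>A\<in>Pow {1..K}. indicator (D A) (history t \<omega>) * (\<integral>\<^sup>+y. gval \<alpha> m A y \<partial>PiM A (\<lambda>k. kern (V k t \<omega>)))) \<partial>M)"
    by (intro nn_integral_sum[symmetric] m2)
  also have "\<dots> = (\<integral>\<^sup>+\<omega>. (\<integral>\<^sup>+y. gval \<alpha> m (S (Suc t) \<omega>) y \<partial>PiM (S (Suc t) \<omega>) (\<lambda>k. kern (V k t \<omega>))) \<partial>M)"
    by (intro nn_integral_cong sum[symmetric])
  finally show ?thesis .
qed

lemma nn_integral_card_sum_Suc:
  assumes t: "1 \<le> t"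
  shows "(\<integral>\<^sup>+\<omega>. (\<Sum>s=Suc t..t + Suc m. of_nat (card (S s \<omega>))) \<partial>M)
    = (\<integral>\<^sup>+\<omega>. of_nat (card (S (Suc t) \<omega>)) \<partial>M) + (\<integral>\<^sup>+\<omega>. (\<Sum>s=Suc (Suc t)..Suc t + m. of_nat (card (S s \<omega>))) \<partial>M)"
proof -
  have "(\<Sum>s=Suc t..t + Suc m. of_nat (card (S s \<omega>))) =
      (of_nat (card (S (Suc t) \<omega>)) + (\<Sum>s=Suc (Suc t)..Suc t + m. of_nat (card (S s \<omega>))) :: ennreal)" for \<omega>
    by (subst sum.atLeast_Suc_atMost) auto
  then show ?thesis by (simp add: nn_integral_add)
qed

lemma nn_integral_card_gval:
  assumes "1 \<le> t" "0 \<le> \<alpha>"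
  shows "(\<integral>\<^sup>+\<omega>. of_nat (card (S (Suc t) \<omega>)) \<partial>M) + (\<integral>\<^sup>+\<omega>. gval \<alpha> m (S (Suc t) \<omega>) (\<lambda>k. V k (Suc t) \<omega>) \<partial>M)
    = (\<integral>\<^sup>+\<omega>. of_nat (card (S (Suc t) \<omega>)) + (\<integral>\<^sup>+y. gval \<alpha> m (S (Suc t) \<omega>) y \<partial>PiM (S (Suc t) \<omega>) (\<lambda>k. kern (V k t \<omega>))) \<partial>M)"
  unfolding nn_integral_gval_next[OF assms]
  using assms by (intro nn_integral_add[symmetric] card_S_meas kern_S_meas) auto

section \<open>Backward induction\<close>

text \<open>Induction on the number \<open>m\<close> of remaining steps, for all starting times: the
  hypothesis at \<open>Suc t\<close> bounds the gain after the next selection, the Markov property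
  rewrites this bound as a kernel integral given time \<open>t\<close>, and the Bellman inequality
  \<open>feasible_le_gval\<close> applies almost surely.\<close>

lemma nn_integral_card_sum_le:
  assumes \<alpha>: "0 \<le> \<alpha>"
    and feas: "\<And>t. 1 \<le> t \<Longrightarrow> AE \<omega> in M. feasible \<alpha> (S (Suc t) \<omega>) (\<lambda>k. V k t \<omega>)"
    and t: "1 \<le> t"
  shows "(\<integral>\<^sup>+\<omega>. (\<Sum>s=Suc t..t + m. of_nat (card (S s \<omega>))) \<partial>M) \<le> (\<integral>\<^sup>+\<omega>. gval \<alpha> m (S t \<omega>) (\<lambda>k. V k t \<omega>) \<partial>M)"
  using t
proof (induction m arbitrary: t)
  case (Suc m)
  have "(\<integral>\<^sup>+\<omega>. (\<Sum>s=Suc t..t + Suc m. of_nat (card (S s \<omega>))) \<partial>M)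
     \<le> (\<integral>\<^sup>+\<omega>. of_nat (card (S (Suc t) \<omega>)) \<partial>M) + (\<integral>\<^sup>+\<omega>. gval \<alpha> m (S (Suc t) \<omega>) (\<lambda>k. V k (Suc t) \<omega>) \<partial>M)"
    unfolding nn_integral_card_sum_Suc[OF Suc.prems] by (intro add_left_mono Suc.IH) simp
  also have "\<dots> \<le> (\<integral>\<^sup>+\<omega>. gval \<alpha> (Suc m) (S t \<omega>) (\<lambda>k. V k t \<omega>) \<partial>M)"
    unfolding nn_integral_card_gval[OF Suc.prems \<alpha>]
  proof (rule nn_integral_mono_AE)
    show "AE \<omega> in M. of_nat (card (S (Suc t) \<omega>)) + (\<integral>\<^sup>+y. gval \<alpha> m (S (Suc t) \<omega>) y \<partial>PiM (S (Suc t) \<omega>) (\<lambda>k. kern (V k t \<omega>)))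
        \<le> gval \<alpha> (Suc m) (S t \<omega>) (\<lambda>k. V k t \<omega>)"
      using feas[OF Suc.prems] AE_space
      by eventually_elim (intro feasible_le_gval S_finite S_Suc Suc.prems \<alpha>)
  qed
  finally show ?case .
qed simp

text \<open>The selection is the one built into \<open>gval\<close>, so the defining equation of
  \<open>gval\<close> takes the place of the Bellman inequality.\<close>

lemma nn_integral_card_sum_greedy:
  assumes \<alpha>: "0 \<le> \<alpha>"
    and greedy: "\<And>t. 1 \<le> t \<Longrightarrow> AE \<omega> in M. S (Suc t) \<omega> = update_rule \<alpha> (S t \<omega>) (\<lambda>k. V k t \<omega>)"
    and t: "1 \<le> t"
  shows "(\<integral>\<^sup>+\<omega>. (\<Sum>s=Suc t..t + m. of_nat (card (S s \<omega>))) \<partial>M) = (\<integral>\<^sup>+\<omega>. gval \<alpha> m (S t \<omega>) (\<lambda>k. V k t \<omega>) \<partial>M)"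
  using t
proof (induction m arbitrary: t)
  case (Suc m)
  have "(\<integral>\<^sup>+\<omega>. (\<Sum>s=Suc t..t + Suc m. of_nat (card (S s \<omega>))) \<partial>M)
     = (\<integral>\<^sup>+\<omega>. of_nat (card (S (Suc t) \<omega>)) \<partial>M) + (\<integral>\<^sup>+\<omega>. gval \<alpha> m (S (Suc t) \<omega>) (\<lambda>k. V k (Suc t) \<omega>) \<partial>M)"
    unfolding nn_integral_card_sum_Suc[OF Suc.prems] using Suc.IH[of "Suc t"] by simp
  also have "\<dots> = (\<integral>\<^sup>+\<omega>. gval \<alpha> (Suc m) (S t \<omega>) (\<lambda>k. V k t \<omega>) \<partial>M)"
    unfolding nn_integral_card_gval[OF Suc.prems \<alpha>]
  proof (rule nn_integral_cong_AE)
    show "AE \<omega> in M. of_nat (card (S (Suc t) \<omega>)) + (\<integral>\<^sup>+y. gval \<alpha> m (S (Suc t) \<omega>) y \<partial>PiM (S (Suc t) \<omega>) (\<lambda>k. kern (V k t \<omega>)))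
        = gval \<alpha> (Suc m) (S t \<omega>) (\<lambda>k. V k t \<omega>)"
      using greedy[OF Suc.prems] by eventually_elim simp
  qed
  finally show ?case .
qed simp

lemma U_meas: "U S t \<in> borel_measurable M"
proof -
  have "(\<lambda>\<omega>. real (card (S s \<omega>))) \<in> borel_measurable M" if "s \<in> {1..t}" for s
    by (rule measurable_S[where f = "\<lambda>A _. real (card A)"]) (use that in auto)
  then show ?thesis unfolding U_def by measurable
qed

lemma U_bound: "\<omega> \<in> space M \<Longrightarrow> U S t \<omega> \<le> real t * real K"
proof -
  assume \<omega>: "\<omega> \<in> space M"
  have "U S t \<omega> \<le> (\<Sum>s=1..t. real K)"
    unfolding U_def
  proof (intro sum_mono)
    fix s assume "s \<in> {1..t}"
    then have "S s \<omega> \<subseteq> {1..K}" using S_subset[of s \<omega>] \<omega> by simp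
    then show "real (card (S s \<omega>)) \<le> real K" using card_mono[of "{1..K}" "S s \<omega>"] by simp
  qed
  then show ?thesis by simp
qed

lemma integral_U: "(\<integral>\<omega>. U S t \<omega> \<partial>M) = enn2real (\<integral>\<^sup>+\<omega>. ennreal (U S t \<omega>) \<partial>M)"
  by (intro integral_eq_nn_integral U_meas AE_I2) (simp add: U_def sum_nonneg)

lemma nn_integral_U_less_top: "(\<integral>\<^sup>+\<omega>. ennreal (U S t \<omega>) \<partial>M) < \<top>"
proof -
  have "(\<integral>\<^sup>+\<omega>. ennreal (U S t \<omega>) \<partial>M) \<le> (\<integral>\<^sup>+\<omega>. ennreal (real t * real K) \<partial>M)"
    by (intro nn_integral_mono ennreal_leI U_bound)
  also have "\<dots> < \<top>" by (simp add: M.emeasure_space_1)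
  finally show ?thesis .
qed

lemma nn_integral_U:
  assumes "1 \<le> t"
  shows "(\<integral>\<^sup>+\<omega>. ennreal (U S t \<omega>) \<partial>M) = of_nat K + (\<integral>\<^sup>+\<omega>. (\<Sum>s=Suc 1..1 + (t - 1). of_nat (card (S s \<omega>))) \<partial>M)"
proof -
  have "(\<integral>\<^sup>+\<omega>. ennreal (U S t \<omega>) \<partial>M) = (\<integral>\<^sup>+\<omega>. of_nat K + (\<Sum>s=Suc 1..1 + (t - 1). of_nat (card (S s \<omega>))) \<partial>M)"
  proof (intro nn_integral_cong)
    fix \<omega> assume \<omega>: "\<omega> \<in> space M"
    have "ennreal (U S t \<omega>) = (\<Sum>s=1..t. of_nat (card (S s \<omega>)))"
      unfolding U_def ennreal_of_nat_eq_real_of_nat by (rule sum_ennreal[symmetric]) simp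
    also have "\<dots> = of_nat (card (S 1 \<omega>)) + (\<Sum>s=Suc 1..t. of_nat (card (S s \<omega>)))"
      using assms by (rule sum.atLeast_Suc_atMost)
    also have "card (S 1 \<omega>) = K" using S_1[OF \<omega>] by simp
    finally show "ennreal (U S t \<omega>) = of_nat K + (\<Sum>s=Suc 1..1 + (t - 1). of_nat (card (S s \<omega>)))"
      using assms by simp
  qed
  also have "\<dots> = of_nat K + (\<integral>\<^sup>+\<omega>. (\<Sum>s=Suc 1..1 + (t - 1). of_nat (card (S s \<omega>))) \<partial>M)"
    by (subst nn_integral_add) (auto simp: M.emeasure_space_1 intro!: borel_measurable_sum card_S_meas)
  finally show ?thesis .
qed

end

section \<open>Compound sequential detection procedures\<close>

lemma space_obs_filt[simp]: "space (obs_filt M N X S t) = space M"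
  by (simp add: obs_filt_def space_measure_of_conv)

lemma sets_obs_filt:
  "sets (obs_filt M N X S t) = sigma_sets (space M)
     ({{\<omega> \<in> space M. S s \<omega> = A} | s A. 1 \<le> s \<and> s \<le> t} \<union>
      {{\<omega> \<in> space M. k \<in> S s \<omega> \<and> X k s \<omega> \<in> B} | s k B. 1 \<le> s \<and> s \<le> t \<and> B \<in> sets N})"
  unfolding obs_filt_def by (rule sets_measure_of) auto

lemma obs_filt_index_set: "1 \<le> s \<Longrightarrow> s \<le> t \<Longrightarrow> {\<omega> \<in> space M. S s \<omega> = A} \<in> sets (obs_filt M N X S t)"
  unfolding sets_obs_filt by (rule sigma_sets.Basic) auto

lemma obs_filt_obs:
  "1 \<le> s \<Longrightarrow> s \<le> t \<Longrightarrow> B \<in> sets N \<Longrightarrow> {\<omega> \<in> space M. k \<in> S s \<omega> \<and> X k s \<omega> \<in> B} \<in> sets (obs_filt M N X S t)"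
  unfolding sets_obs_filt by (rule sigma_sets.Basic) auto

lemma obs_filt_cong_sets:
  assumes "sets N = sets N'"
  shows "obs_filt M N X S t = obs_filt M N' X S t"
  unfolding obs_filt_def assms ..

lemma measurable_finite_index_sets:
  fixes S :: "'w \<Rightarrow> 'a set"
  assumes "finite I" "\<And>\<omega>. \<omega> \<in> space F \<Longrightarrow> S \<omega> \<subseteq> I" "\<And>A. A \<subseteq> I \<Longrightarrow> {\<omega> \<in> space F. S \<omega> = A} \<in> sets F"
  shows "S \<in> measurable F (count_space UNIV)"
proof (rule measurableI)
  fix \<A> :: "'a set set"
  have "S -` \<A> \<inter> space F = (\<Union>A\<in>\<A> \<inter> Pow I. {\<omega> \<in> space F. S \<omega> = A})" using assms(2) by auto
  also have "\<dots> \<in> sets F" using assms(1,3) by (intro sets.finite_UN) auto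
  finally show "S -` \<A> \<inter> space F \<in> sets F" .
qed simp

locale procedure = change_model \<nu> p q \<theta> M K \<tau> X
  for \<nu> :: "'x measure" and p q :: "'x \<Rightarrow> real" and \<theta> :: real and M :: "'w measure"
    and K :: nat and \<tau> :: "nat \<Rightarrow> 'w \<Rightarrow> nat" and X :: "nat \<Rightarrow> nat \<Rightarrow> 'w \<Rightarrow> 'x" +
  fixes S :: "nat \<Rightarrow> 'w \<Rightarrow> nat set"
  assumes proc: "is_procedure M \<nu> K X S"
begin

abbreviation "F t \<equiv> obs_filt M \<nu> X S t"

abbreviation "H t \<equiv> vimage_algebra (space M) (history t) (hist_space t)"

lemma proc_S_1: "\<omega> \<in> space M \<Longrightarrow> S 1 \<omega> = {1..K}"
  using proc by (simp add: is_procedure_def)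

lemma proc_S_Suc: "1 \<le> t \<Longrightarrow> \<omega> \<in> space M \<Longrightarrow> S (Suc t) \<omega> \<subseteq> S t \<omega>"
  using proc by (simp add: is_procedure_def)

lemma proc_S_meas: "1 \<le> t \<Longrightarrow> S (Suc t) \<in> measurable (F t) (count_space UNIV)"
  using proc by (simp add: is_procedure_def)

lemma proc_S_antimono:
  assumes "1 \<le> s" "s \<le> t" "\<omega> \<in> space M"
  shows "S t \<omega> \<subseteq> S s \<omega>"
  using assms(2)
proof (induction t rule: dec_induct)
  case (step n)
  then show ?case using proc_S_Suc[of n \<omega>] assms by simp
qed simp

lemma proc_S_subset: "1 \<le> t \<Longrightarrow> \<omega> \<in> space M \<Longrightarrow> S t \<omega> \<subseteq> {1..K}"
  using proc_S_antimono[of 1 t \<omega>] proc_S_1 by simp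

lemma history_meas_H: "history t \<in> measurable (H t) (hist_space t)"
  using measurable_space[OF history_meas] by (intro measurable_vimage_algebra1) auto

lemma X_meas_H:
  assumes "k \<in> {1..K}" "1 \<le> s" "s \<le> t"
  shows "X k s \<in> measurable (H t) \<nu>"
proof -
  have ks: "(k, s) \<in> obs_idx t" using assms by (simp add: obs_idx_def)
  have "(\<lambda>\<omega>. history t \<omega> (k, s)) \<in> measurable (H t) \<nu>"
    by (rule measurable_compose[OF history_meas_H measurable_component_singleton[OF ks]])
  then show ?thesis using ks by (simp add: history_def)
qed

lemma H_mono:
  assumes "s \<le> t"
  shows "sets (H s) \<subseteq> sets (H t)"
proof -
  have sub: "obs_idx s \<subseteq> obs_idx t" using assms by (auto simp: obs_idx_def)
  have "(\<lambda>\<omega>. restrict (history t \<omega>) (obs_idx s)) \<in> measurable (H t) (hist_space s)"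
    by (rule measurable_compose[OF history_meas_H measurable_restrict_subset[OF sub]])
  moreover have "(\<lambda>\<omega>. restrict (history t \<omega>) (obs_idx s)) = history s"
    using sub by (auto simp: history_def fun_eq_iff)
  ultimately have m: "history s \<in> measurable (H t) (hist_space s)" by simp
  have "history s \<in> space M \<rightarrow> space (hist_space s)" using measurable_space[OF history_meas] by auto
  from sets_vimage_algebra2[OF this] show ?thesis
    using measurable_sets[OF m] by auto
qed

text \<open>\<open>F t\<close> is generated by sets which must themselves be measurable for earlier
  stages of the filtration. Strong induction resolves this: \<open>S 1\<close> is constant, each
  later \<open>S s\<close> is measurable at time \<open>s - 1\<close>, and observed values are
  values of the full record on events already placed in \<open>H t\<close>.\<close>

lemma F_subset_H: "sets (F t) \<subseteq> sets (H t)"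
proof (induction t rule: less_induct)
  case (less t)
  have idx: "{\<omega> \<in> space M. S s \<omega> = A} \<in> sets (H t)" if s: "1 \<le> s" "s \<le> t" for s A
  proof (cases "s = 1")
    case True
    then have "{\<omega> \<in> space M. S s \<omega> = A} = (if A = {1..K} then space (H t) else {})"
      using proc_S_1 by auto
    then show ?thesis using sets.top[of "H t"] by simp
  next
    case False
    define r where "r = s - 1"
    have r: "s = Suc r" "1 \<le> r" "r < t" using False s by (auto simp: r_def)
    have "S s -` {A} \<inter> space (F r) \<in> sets (F r)"
      unfolding r(1) by (rule measurable_sets[OF proc_S_meas[OF r(2)]]) simp
    moreover have "S s -` {A} \<inter> space (F r) = {\<omega> \<in> space M. S s \<omega> = A}" by auto
    ultimately have "{\<omega> \<in> space M. S s \<omega> = A} \<in> sets (F r)" by simp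
    then show ?thesis using less.IH[OF r(3)] H_mono[of r t] r(3) by auto
  qed
  have obs: "{\<omega> \<in> space M. k \<in> S s \<omega> \<and> X k s \<omega> \<in> B} \<in> sets (H t)"
    if s: "1 \<le> s" "s \<le> t" and B: "B \<in> sets \<nu>" for s k B
  proof (cases "k \<in> {1..K}")
    case True
    have "{\<omega> \<in> space M. k \<in> S s \<omega> \<and> X k s \<omega> \<in> B}
      = (\<Union>A\<in>{A \<in> Pow {1..K}. k \<in> A}. {\<omega> \<in> space M. S s \<omega> = A}) \<inter> (X k s -` B \<inter> space (H t))"
      using proc_S_subset[OF s(1)] by auto
    also have "\<dots> \<in> sets (H t)"
      by (rule sets.Int[OF sets.finite_UN measurable_sets[OF X_meas_H[OF True s] B]]) (use idx[OF s] in auto)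
    finally show ?thesis .
  next
    case False
    then have "{\<omega> \<in> space M. k \<in> S s \<omega> \<and> X k s \<omega> \<in> B} = {}"
      using proc_S_subset[OF s(1)] by blast
    then show ?thesis by (simp only: sets.empty_sets)
  qed
  have "sigma_sets (space (H t))
     ({{\<omega> \<in> space M. S s \<omega> = A} | s A. 1 \<le> s \<and> s \<le> t} \<union>
      {{\<omega> \<in> space M. k \<in> S s \<omega> \<and> X k s \<omega> \<in> B} | s k B. 1 \<le> s \<and> s \<le> t \<and> B \<in> sets \<nu>}) \<subseteq> sets (H t)"
    using idx obs by (intro sets.sigma_sets_subset) auto
  then show ?case unfolding sets_obs_filt by simp
qed

lemma sets_F_D: "E \<in> sets (F t) \<Longrightarrow> \<exists>D\<in>sets (hist_space t). E = history t -` D \<inter> space M"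
proof -
  assume "E \<in> sets (F t)"
  then have E: "E \<in> sets (H t)" using F_subset_H by auto
  have "history t \<in> space M \<rightarrow> space (hist_space t)" using measurable_space[OF history_meas] by auto
  from sets_vimage_algebra2[OF this] E show ?thesis by auto
qed

lemma subalgebra_F: "subalgebra M (F t)"
  unfolding subalgebra_def
proof (intro conjI subsetI)
  fix E assume "E \<in> sets (F t)"
  then obtain D where D: "D \<in> sets (hist_space t)" "E = history t -` D \<inter> space M" using sets_F_D by metis
  show "E \<in> sets M" unfolding D(2) by (rule measurable_sets[OF history_meas D(1)])
qed simp

sublocale adapted_sets \<nu> p q \<theta> M K \<tau> X S
proof
  fix t A assume t: "1 \<le> (t :: nat)"
  have "{\<omega> \<in> space (F t). S (Suc t) \<omega> = A} \<in> sets (F t)"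
    using measurable_sets[OF proc_S_meas[OF t], of "{A}"] by (simp add: vimage_def Int_def conj_commute)
  then have "{\<omega> \<in> space M. S (Suc t) \<omega> = A} \<in> sets (F t)" by simp
  then show "\<exists>D\<in>sets (hist_space t). {\<omega> \<in> space M. S (Suc t) \<omega> = A} = history t -` D \<inter> space M"
    by (rule sets_F_D)
qed (use proc_S_1 proc_S_Suc in auto)

lemma active_in_F:
  assumes "k \<in> {1..K}" "1 \<le> t"
  shows "{\<omega> \<in> space M. k \<in> S t \<omega>} \<in> sets (F t)"
proof -
  have "{\<omega> \<in> space M. k \<in> S t \<omega>} = {\<omega> \<in> space M. k \<in> S t \<omega> \<and> X k t \<omega> \<in> space \<nu>}"
    using measurable_space[OF X_meas[OF assms]] by auto
  then show ?thesis using obs_filt_obs[OF assms(2) order_refl sets.top] by simp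
qed

text \<open>As the sets only shrink, a stream active at \<open>t\<close> has been observed at every
  earlier time, so on that event each step of the recursion reads available data. Off the event data
  may be missing, hence the restricted space.\<close>

lemma V_meas_F:
  assumes k: "k \<in> {1..K}" and t: "1 \<le> t" and "s \<le> t"
  shows "V k s \<in> borel_measurable (restrict_space (F t) {\<omega> \<in> space M. k \<in> S t \<omega>})"
  using assms(3)
proof (induction s)
  case 0
  have "V k 0 = (\<lambda>_. 0)" by (simp add: V_def fun_eq_iff)
  then show ?case by simp
next
  case (Suc s)
  let ?E = "{\<omega> \<in> space M. k \<in> S t \<omega>}" and ?R = "restrict_space (F t) {\<omega> \<in> space M. k \<in> S t \<omega>}"
  have [measurable]: "V k s \<in> borel_measurable ?R" using Suc by simp
  have [measurable]: "X k (Suc s) \<in> measurable ?R \<nu>"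
  proof (rule measurableI)
    fix \<omega> assume "\<omega> \<in> space ?R"
    then show "X k (Suc s) \<omega> \<in> space \<nu>"
      using measurable_space[OF X_meas[OF k, of "Suc s"]] by (simp add: space_restrict_space)
  next
    fix B assume B: "B \<in> sets \<nu>"
    have "X k (Suc s) -` B \<inter> space ?R = ?E \<inter> {\<omega> \<in> space M. k \<in> S (Suc s) \<omega> \<and> X k (Suc s) \<omega> \<in> B}"
      using proc_S_antimono[of "Suc s" t] Suc.prems by (auto simp: space_restrict_space)
    then show "X k (Suc s) -` B \<inter> space ?R \<in> sets ?R"
      using obs_filt_obs[of "Suc s" t B \<nu> M k S X] B Suc.prems by (auto simp: sets_restrict_space)
  qed
  have "V k (Suc s) = (\<lambda>\<omega>. post_next (V k s \<omega>) (X k (Suc s) \<omega>))" by (simp add: V_def fun_eq_iff)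
  then show ?case by simp
qed

lemma finite_measure_subalgebra_F: "finite_measure_subalgebra M (F t)"
  by (intro finite_measure_subalgebra.intro finite_measure_subalgebra_axioms.intro M.finite_measure_axioms subalgebra_F)

text \<open>On the event that stream \<open>k\<close> is still observed, its complete history is available, so that conditioning on
  \<open>F t\<close> amounts to conditioning on all observations.\<close>

lemma posterior_eq_V:
  assumes k: "k \<in> {1..K}" and t: "1 \<le> t"
  shows "AE \<omega> in M. k \<in> S t \<omega> \<longrightarrow> posterior M \<nu> X \<tau> S t k \<omega> = V k t \<omega>"
proof -
  interpret F: finite_measure_subalgebra M "F t" by (rule finite_measure_subalgebra_F)
  note [measurable] = tau_meas[OF k]
  let ?E = "{\<omega> \<in> space M. k \<in> S t \<omega>}" and ?f = "indicator {\<omega> \<in> space M. \<tau> k \<omega> < t} :: 'w \<Rightarrow> real"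
  have EF[measurable]: "?E \<in> sets (F t)" by (rule active_in_F[OF k t])
  then have EM[measurable]: "?E \<in> sets M" using subalgebra_F[of t] unfolding subalgebra_def by blast
  have gF[measurable]: "(\<lambda>\<omega>. indicator ?E \<omega> * V k t \<omega>) \<in> borel_measurable (F t)"
    using V_meas_F[OF k t order_refl] EF
    by (subst (asm) borel_measurable_restrict_space_iff) (auto simp: Int_absorb2 subset_eq)
  note [measurable] = V_meas[OF k]
  have f_int: "integrable M (\<lambda>\<omega>. indicator ?E \<omega> * ?f \<omega>)"
    by (rule M.integrable_const_bound[where B = 1]) (auto simp: indicator_def)
  have g_int: "integrable M (\<lambda>\<omega>. indicator ?E \<omega> * V k t \<omega>)"
    using V_bounds by (intro M.integrable_const_bound[where B = 1]) (auto simp: indicator_def)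
  \<comment> \<open>\<open>V k t\<close> itself need not be measurable for \<open>F t\<close>, so
    both functions are cut off to \<open>?E\<close> before the conditional expectation is
    characterized by its integrals.\<close>
  have "AE \<omega> in M. real_cond_exp M (F t) (\<lambda>\<omega>. indicator ?E \<omega> * ?f \<omega>) \<omega> = indicator ?E \<omega> * V k t \<omega>"
  proof (rule F.real_cond_exp_charact[OF _ f_int g_int gF])
    fix A assume A: "A \<in> sets (F t)"
    then obtain D where D[measurable]: "D \<in> sets (hist_space t)" and AD: "A \<inter> ?E = history t -` D \<inter> space M"
      using sets_F_D[of "A \<inter> ?E" t] EF by blast
    have ind: "indicator A \<omega> * indicator ?E \<omega> = (indicator D (history t \<omega>) :: real)" if "\<omega> \<in> space M" for \<omega>
      using AD that by (auto simp: indicator_def split: if_splits)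
    have "(\<integral>\<omega>\<in>A. (indicator ?E \<omega> * ?f \<omega>) \<partial>M) = (\<integral>\<omega>. indicator {\<omega> \<in> space M. \<tau> k \<omega> < t \<and> history t \<omega> \<in> D} \<omega> \<partial>M)"
      unfolding set_lebesgue_integral_def
      by (intro Bochner_Integration.integral_cong refl) (simp add: mult.assoc[symmetric] ind, auto simp: indicator_def)
    also have "\<dots> = measure M {\<omega> \<in> space M. \<tau> k \<omega> < t \<and> history t \<omega> \<in> D}"
      by simp
    also have "\<dots> = enn2real (\<integral>\<^sup>+\<omega>. ennreal (V k t \<omega>) * indicator D (history t \<omega>) \<partial>M)"
      unfolding measure_def emeasure_change_before[OF k D] vpost_history[OF k] ..
    also have "(\<integral>\<^sup>+\<omega>. ennreal (V k t \<omega>) * indicator D (history t \<omega>) \<partial>M)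
       = (\<integral>\<^sup>+\<omega>. ennreal (V k t \<omega> * indicator D (history t \<omega>)) \<partial>M)"
      by (intro nn_integral_cong) (auto simp: indicator_def)
    also have "enn2real \<dots> = (\<integral>\<omega>. V k t \<omega> * indicator D (history t \<omega>) \<partial>M)"
      using V_bounds by (intro integral_eq_nn_integral[symmetric]) auto
    also have "\<dots> = (\<integral>\<omega>\<in>A. (indicator ?E \<omega> * V k t \<omega>) \<partial>M)"
      unfolding set_lebesgue_integral_def
      by (intro Bochner_Integration.integral_cong refl) (simp flip: ind)
    finally show "(\<integral>\<omega>\<in>A. (indicator ?E \<omega> * ?f \<omega>) \<partial>M) = (\<integral>\<omega>\<in>A. (indicator ?E \<omega> * V k t \<omega>) \<partial>M)" .
  qed
  moreover have "AE \<omega> in M. real_cond_exp M (F t) (\<lambda>\<omega>. indicator ?E \<omega> * ?f \<omega>) \<omega> = indicator ?E \<omega> * real_cond_exp M (F t) ?f \<omega>"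
    by (rule F.real_cond_exp_mult[OF _ _ f_int]) auto
  ultimately show ?thesis
    using AE_space
  proof eventually_elim
    case (elim \<omega>)
    then show ?case by (auto simp: posterior_def indicator_def)
  qed
qed

text \<open>\<open>S (Suc t)\<close> is known at time \<open>t\<close>, so the weight of each stream
  comes out of the conditional expectation and leaves its posterior; selected streams are active,
  where the posterior is \<open>V\<close>.\<close>

lemma LFNR_next_eq:
  assumes t: "1 \<le> t"
  shows "AE \<omega> in M. LFNR_next M \<nu> X \<tau> S t \<omega> = (\<Sum>k\<in>S (Suc t) \<omega>. V k t \<omega>) / real (max (card (S (Suc t) \<omega>)) 1)"
proof -
  interpret F: finite_measure_subalgebra M "F t" by (rule finite_measure_subalgebra_F)
  define c where "c k A = (if k \<in> A then 1 / real (max (card A) 1) else 0)" for k :: nat and A :: "nat set"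
  define f where "f k = (indicator {\<omega> \<in> space M. \<tau> k \<omega> < t} :: 'w \<Rightarrow> real)" for k
  \<comment> \<open>Outside \<open>1..K\<close> the \<open>\<tau> k\<close> need not be measurable;
    the value 0 makes \<open>h k\<close> integrable for every index.\<close>
  define h where "h k \<omega> = (if k \<in> {1..K} then c k (S (Suc t) \<omega>) * f k \<omega> else 0)" for k \<omega>
  have cF[measurable]: "(\<lambda>\<omega>. c k (S (Suc t) \<omega>)) \<in> borel_measurable (F t)" for k
    by (rule measurable_compose[OF proc_S_meas[OF t]]) simp
  then have cM[measurable]: "(\<lambda>\<omega>. c k (S (Suc t) \<omega>)) \<in> borel_measurable M" for k
    using measurable_from_subalg[OF subalgebra_F] by blast
  have fM[measurable]: "f k \<in> borel_measurable M" if "k \<in> {1..K}" for k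
  proof -
    note [measurable] = tau_meas[OF that]
    show ?thesis unfolding f_def by measurable
  qed
  have c_bound: "0 \<le> c k A" "c k A \<le> 1" for k A by (auto simp: c_def divide_simps)
  have f_bound: "0 \<le> f k \<omega>" "f k \<omega> \<le> 1" for k \<omega> by (auto simp: f_def indicator_def)
  have cf_int: "integrable M (\<lambda>\<omega>. c k (S (Suc t) \<omega>) * f k \<omega>)" if "k \<in> {1..K}" for k
  proof (rule M.integrable_const_bound[where B = 1])
    show "AE \<omega> in M. norm (c k (S (Suc t) \<omega>) * f k \<omega>) \<le> 1"
      using c_bound f_bound by (intro AE_I2) (simp add: abs_mult mult_le_one)
  qed (use that in measurable)
  then have h_int: "integrable M (h k)" for k
    unfolding h_def by (cases "k \<in> {1..K}") auto
  have FNP: "FNP_next \<tau> S t \<omega> = (\<Sum>k\<in>{1..K}. h k \<omega>)" if \<omega>: "\<omega> \<in> space M" for \<omega>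
  proof -
    have "(\<Sum>k\<in>{1..K}. h k \<omega>) = (\<Sum>k\<in>S (Suc t) \<omega>. h k \<omega>)"
      using S_subset[of "Suc t" \<omega>] \<omega> by (intro sum.mono_neutral_right) (auto simp: h_def c_def)
    also have "\<dots> = (\<Sum>k\<in>S (Suc t) \<omega>. (if \<tau> k \<omega> < t then 1 else 0) / real (max (card (S (Suc t) \<omega>)) 1))"
      using S_subset[of "Suc t" \<omega>] \<omega> by (intro sum.cong refl) (auto simp: h_def c_def f_def subset_iff)
    finally show ?thesis by (simp add: FNP_next_def sum_divide_distrib)
  qed
  have FNP_meas: "FNP_next \<tau> S t \<in> borel_measurable M"
  proof (subst measurable_cong[OF FNP])
    show "(\<lambda>\<omega>. \<Sum>k\<in>{1..K}. h k \<omega>) \<in> borel_measurable M"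
      using h_int by (intro borel_measurable_sum) auto
  qed
  have "AE \<omega> in M. LFNR_next M \<nu> X \<tau> S t \<omega> = real_cond_exp M (F t) (\<lambda>\<omega>. \<Sum>k\<in>{1..K}. h k \<omega>) \<omega>"
    unfolding LFNR_next_def
    by (rule F.real_cond_exp_cong) (use FNP FNP_meas h_int in \<open>auto intro!: AE_I2\<close>)
  moreover have "AE \<omega> in M. real_cond_exp M (F t) (\<lambda>\<omega>. \<Sum>k\<in>{1..K}. h k \<omega>) \<omega> = (\<Sum>k\<in>{1..K}. real_cond_exp M (F t) (h k) \<omega>)"
    using h_int by (rule F.real_cond_exp_sum)
  moreover have "AE \<omega> in M. \<forall>k\<in>{1..K}. real_cond_exp M (F t) (h k) \<omega> = c k (S (Suc t) \<omega>) * posterior M \<nu> X \<tau> S t k \<omega>"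
  proof (intro AE_finite_allI)
    fix k assume k: "k \<in> {1..K}"
    have "h k = (\<lambda>\<omega>. c k (S (Suc t) \<omega>) * f k \<omega>)" using k by (auto simp: h_def)
    then show "AE \<omega> in M. real_cond_exp M (F t) (h k) \<omega> = c k (S (Suc t) \<omega>) * posterior M \<nu> X \<tau> S t k \<omega>"
      using F.real_cond_exp_mult[OF cF fM[OF k] cf_int[OF k]] by (simp add: posterior_def f_def)
  qed simp
  moreover have "AE \<omega> in M. \<forall>k\<in>{1..K}. k \<in> S t \<omega> \<longrightarrow> posterior M \<nu> X \<tau> S t k \<omega> = V k t \<omega>"
    by (intro AE_finite_allI posterior_eq_V t) auto
  ultimately show ?thesis
    using AE_space
  proof eventually_elim
    case (elim \<omega>)
    have "LFNR_next M \<nu> X \<tau> S t \<omega> = (\<Sum>k\<in>{1..K}. c k (S (Suc t) \<omega>) * posterior M \<nu> X \<tau> S t k \<omega>)"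
      using elim by simp
    also have "\<dots> = (\<Sum>k\<in>S (Suc t) \<omega>. c k (S (Suc t) \<omega>) * posterior M \<nu> X \<tau> S t k \<omega>)"
      using S_subset[of "Suc t" \<omega>] elim by (intro sum.mono_neutral_right) (auto simp: c_def)
    also have "\<dots> = (\<Sum>k\<in>S (Suc t) \<omega>. V k t \<omega> / real (max (card (S (Suc t) \<omega>)) 1))"
    proof (intro sum.cong refl)
      fix k assume k: "k \<in> S (Suc t) \<omega>"
      then have "k \<in> {1..K}" "k \<in> S t \<omega>"
        using S_subset[of "Suc t" \<omega>] S_Suc[OF t, of \<omega>] elim by auto
      then show "c k (S (Suc t) \<omega>) * posterior M \<nu> X \<tau> S t k \<omega> = V k t \<omega> / real (max (card (S (Suc t) \<omega>)) 1)"
        using elim k by (simp add: c_def)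
    qed
    finally show ?case by (simp add: sum_divide_distrib)
  qed
qed

text \<open>On an empty selection both conditions hold, as \<alpha> is nonnegative; otherwise
  multiplication by the size of the selection turns one into the other.\<close>

lemma LFNR_next_le_iff:
  assumes "1 \<le> t" "0 \<le> \<alpha>"
  shows "(AE \<omega> in M. LFNR_next M \<nu> X \<tau> S t \<omega> \<le> \<alpha>) \<longleftrightarrow> (AE \<omega> in M. feasible \<alpha> (S (Suc t) \<omega>) (\<lambda>k. V k t \<omega>))"
proof -
  have "AE \<omega> in M. LFNR_next M \<nu> X \<tau> S t \<omega> \<le> \<alpha> \<longleftrightarrow> feasible \<alpha> (S (Suc t) \<omega>) (\<lambda>k. V k t \<omega>)"
    using LFNR_next_eq[OF assms(1)] AE_space
  proof eventually_elim
    case (elim \<omega>)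
    have fin: "finite (S (Suc t) \<omega>)" using S_finite elim by simp
    show ?case
    proof (cases "S (Suc t) \<omega> = {}")
      case True
      then show ?thesis using elim assms(2) by (simp add: feasible_def)
    next
      case False
      then have pos: "0 < card (S (Suc t) \<omega>)" using fin by (simp add: card_gt_0_iff)
      then have "max (card (S (Suc t) \<omega>)) 1 = card (S (Suc t) \<omega>)" by simp
      with pos show ?thesis using elim by (simp add: feasible_def pos_divide_le_eq)
    qed
  qed
  then show ?thesis by (auto elim: AE_mp)
qed

end

context change_model
begin

section \<open>Admissibility and optimality of the greedy procedure\<close>

text \<open>The posteriors are conditional expectations, hence measurable for the observed
  filtration; as \<open>S t\<close> takes finitely many values, \<open>sets_update_rule_eq\<close>
  gives measurability of the next set.\<close>

lemma is_Tstar_is_procedure: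
  assumes "is_Tstar M \<nu> K X \<tau> \<alpha> S" "0 \<le> \<alpha>"
  shows "is_procedure M \<nu> K X S"
proof -
  have S1: "S 1 \<omega> = {1..K}" if "\<omega> \<in> space M" for \<omega>
    using assms that by (simp add: is_Tstar_def)
  have Seq: "S (Suc t) \<omega> = update_rule \<alpha> (S t \<omega>) (\<lambda>k. posterior M \<nu> X \<tau> S t k \<omega>)"
    if "1 \<le> t" "\<omega> \<in> space M" for t \<omega>
    using assms that by (simp add: is_Tstar_def)
  have SSuc: "S (Suc t) \<omega> \<subseteq> S t \<omega>" if "1 \<le> t" "\<omega> \<in> space M" for t \<omega>
    unfolding Seq[OF that] by (rule update_rule_subset)
  have sub: "S t \<omega> \<subseteq> {1..K}" if "1 \<le> t" "\<omega> \<in> space M" for t \<omega>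
    using that(1)
  proof (induction t rule: dec_induct)
    case base
    then show ?case using S1[OF that(2)] by simp
  next
    case (step n)
    then show ?case using SSuc[OF _ that(2), of n] by simp
  qed
  have "S (Suc t) \<in> measurable (obs_filt M \<nu> X S t) (count_space UNIV)" if t: "1 \<le> t" for t
  proof (rule measurable_finite_index_sets[where I = "{1..K}"])
    let ?F = "obs_filt M \<nu> X S t"
    show "S (Suc t) \<omega> \<subseteq> {1..K}" if "\<omega> \<in> space ?F" for \<omega> using sub[of "Suc t" \<omega>] that by simp
    fix C :: "nat set"
    have post: "posterior M \<nu> X \<tau> S t k \<in> borel_measurable ?F" for k
      unfolding posterior_def by (rule borel_measurable_cond_exp)
    have "{\<omega> \<in> space ?F. S (Suc t) \<omega> = C} =
      (\<Union>A\<in>Pow {1..K}. {\<omega> \<in> space ?F. S t \<omega> = A} \<inter> {\<omega> \<in> space ?F. update_rule \<alpha> A (\<lambda>k. posterior M \<nu> X \<tau> S t k \<omega>) = C})"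
      using sub[OF t] Seq[OF t] by auto
    also have "\<dots> \<in> sets ?F"
    proof (intro sets.finite_UN sets.Int)
      fix A assume "A \<in> Pow {1..K}"
      then have "finite A" using finite_subset by auto
      then show "{\<omega> \<in> space ?F. update_rule \<alpha> A (\<lambda>k. posterior M \<nu> X \<tau> S t k \<omega>) = C} \<in> sets ?F"
        by (intro sets_update_rule_eq assms post)
      show "{\<omega> \<in> space ?F. S t \<omega> = A} \<in> sets ?F"
        using obs_filt_index_set[OF t order_refl] by simp
    qed simp
    finally show "{\<omega> \<in> space ?F. S (Suc t) \<omega> = C} \<in> sets ?F" .
  qed simp
  then show ?thesis unfolding is_procedure_def using S1 SSuc by blast
qed

lemma is_Tstar_optimal:
  assumes star: "is_Tstar M \<nu> K X \<tau> \<alpha> S" and \<alpha>: "0 \<le> \<alpha>"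
  shows "S \<in> T_alpha M \<nu> K X \<tau> \<alpha>"
    and "1 \<le> t \<Longrightarrow> S' \<in> T_alpha M \<nu> K X \<tau> \<alpha> \<Longrightarrow> (\<integral>\<omega>. U S' t \<omega> \<partial>M) \<le> (\<integral>\<omega>. U S t \<omega> \<partial>M)"
proof -
  interpret S: procedure \<nu> p q \<theta> M K \<tau> X S
    by standard (rule is_Tstar_is_procedure[OF assms])
  have greedy: "AE \<omega> in M. S (Suc t) \<omega> = update_rule \<alpha> (S t \<omega>) (\<lambda>k. V k t \<omega>)" if t: "1 \<le> t" for t
  proof -
    have "AE \<omega> in M. \<forall>k\<in>{1..K}. k \<in> S t \<omega> \<longrightarrow> posterior M \<nu> X \<tau> S t k \<omega> = V k t \<omega>"
      by (intro AE_finite_allI S.posterior_eq_V t) auto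
    then show ?thesis
      using AE_space
    proof eventually_elim
      case (elim \<omega>)
      have "S (Suc t) \<omega> = update_rule \<alpha> (S t \<omega>) (\<lambda>k. posterior M \<nu> X \<tau> S t k \<omega>)"
        using star t elim by (simp add: is_Tstar_def)
      also have "\<dots> = update_rule \<alpha> (S t \<omega>) (\<lambda>k. V k t \<omega>)"
        using S.S_subset[OF t, of \<omega>] elim by (intro update_rule_cong) auto
      finally show ?case .
    qed
  qed
  have "AE \<omega> in M. LFNR_next M \<nu> X \<tau> S t \<omega> \<le> \<alpha>" if t: "1 \<le> t" for t
    unfolding S.LFNR_next_le_iff[OF t \<alpha>]
    using greedy[OF t] AE_space
  proof eventually_elim
    case (elim \<omega>)
    show ?case unfolding elim(1) by (intro feasible_update_rule S.S_finite t elim \<alpha>)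
  qed
  then show "S \<in> T_alpha M \<nu> K X \<tau> \<alpha>"
    using S.proc \<alpha> by (auto simp: T_alpha_def)
  assume t: "1 \<le> t" and S': "S' \<in> T_alpha M \<nu> K X \<tau> \<alpha>"
  interpret S': procedure \<nu> p q \<theta> M K \<tau> X S'
    by standard (use S' in \<open>simp add: T_alpha_def\<close>)
  have feas: "AE \<omega> in M. feasible \<alpha> (S' (Suc t) \<omega>) (\<lambda>k. V k t \<omega>)" if "1 \<le> t" for t
    using S' that S'.LFNR_next_le_iff[OF that \<alpha>] by (simp add: T_alpha_def)
  \<comment> \<open>Both procedures start from \<open>{1..K}\<close>, and \<open>V\<close> refers to
    the same data, so the upper bound for the competitor and the exact value of the greedy procedure
    are the same integral.\<close>
  have "(\<integral>\<^sup>+\<omega>. gval \<alpha> (t - 1) (S' 1 \<omega>) (\<lambda>k. V k 1 \<omega>) \<partial>M) = (\<integral>\<^sup>+\<omega>. gval \<alpha> (t - 1) (S 1 \<omega>) (\<lambda>k. V k 1 \<omega>) \<partial>M)"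
    by (intro nn_integral_cong) (simp only: S.S_1 S'.S_1)
  then have "(\<integral>\<^sup>+\<omega>. ennreal (U S' t \<omega>) \<partial>M) \<le> (\<integral>\<^sup>+\<omega>. ennreal (U S t \<omega>) \<partial>M)"
    unfolding S.nn_integral_U[OF t] S'.nn_integral_U[OF t]
    using S'.nn_integral_card_sum_le[OF \<alpha> feas, of 1 "t - 1"] S.nn_integral_card_sum_greedy[OF \<alpha> greedy, of 1 "t - 1"]
    by (intro add_left_mono) simp
  then show "(\<integral>\<omega>. U S' t \<omega> \<partial>M) \<le> (\<integral>\<omega>. U S t \<omega> \<partial>M)"
    unfolding S.integral_U S'.integral_U by (intro enn2real_mono S.nn_integral_U_less_top)
qed

end

text \<open>The baseline measure of the theorem need not be \<open>\<sigma>\<close>-finite, as product measures require; the probability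
  measure with density \<open>(p + q) / 2\<close> takes its place.\<close>

lemma dominating_prob_space:
  fixes p q :: "'x \<Rightarrow> real"
  assumes nn: "\<And>x. 0 \<le> p x" "\<And>x. 0 \<le> q x"
    and [measurable]: "p \<in> borel_measurable N" "q \<in> borel_measurable N"
    and int: "(\<integral>\<^sup>+x. ennreal (p x) \<partial>N) = 1" "(\<integral>\<^sup>+x. ennreal (q x) \<partial>N) = 1"
  obtains \<nu> p' q' where "prob_space \<nu>" "sets \<nu> = sets N" "\<And>x. 0 \<le> p' x" "\<And>x. 0 \<le> q' x"
    "p' \<in> borel_measurable \<nu>" "q' \<in> borel_measurable \<nu>"
    "density \<nu> (\<lambda>x. ennreal (p' x)) = density N (\<lambda>x. ennreal (p x))"
    "density \<nu> (\<lambda>x. ennreal (q' x)) = density N (\<lambda>x. ennreal (q x))"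
proof -
  define c :: real where "c = 1 / 2"
  have c: "0 < c" "c + c = 1" by (simp_all add: c_def)
  define \<nu> where "\<nu> = density N (\<lambda>x. ennreal (c * (p x + q x)))"
  \<comment> \<open>The density relative to \<nu> of the measure with density \<open>r\<close>
    relative to \<open>N\<close>. Where \<open>p + q\<close> vanishes, so does every
    \<open>r\<close> with \<open>0 \<le> r \<le> p + q\<close>, and the default value 0 of division
    is right.\<close>
  define d where "d r x = r x / (c * (p x + q x))" for r :: "'x \<Rightarrow> real" and x
  have d_meas: "d r \<in> borel_measurable N" if [measurable]: "r \<in> borel_measurable N" for r
    unfolding d_def[abs_def] by measurable
  have d: "density \<nu> (\<lambda>x. ennreal (d r x)) = density N (\<lambda>x. ennreal (r x))"
    if [measurable]: "r \<in> borel_measurable N" and r: "\<And>x. 0 \<le> r x" "\<And>x. r x \<le> p x + q x" for r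
  proof -
    have "density \<nu> (\<lambda>x. ennreal (d r x)) = density N (\<lambda>x. ennreal (c * (p x + q x)) * ennreal (d r x))"
      unfolding \<nu>_def d_def by (intro density_density_eq) measurable
    also have "(\<lambda>x. ennreal (c * (p x + q x)) * ennreal (d r x)) = (\<lambda>x. ennreal (r x))"
    proof
      fix x
      have "c * (p x + q x) * d r x = r x"
        using r[of x] c by (cases "p x + q x = 0") (auto simp: d_def)
      moreover have "0 \<le> c * (p x + q x)" "0 \<le> d r x" using nn r c by (auto simp: d_def)
      ultimately show "ennreal (c * (p x + q x)) * ennreal (d r x) = ennreal (r x)"
        by (simp add: ennreal_mult'[symmetric])
    qed
    finally show ?thesis .
  qed
  show ?thesis
  proof (rule that[of \<nu> "d p" "d q"])
    show "prob_space \<nu>"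
    proof (rule prob_spaceI)
      have "emeasure \<nu> (space \<nu>) = (\<integral>\<^sup>+x. ennreal (c * (p x + q x)) * indicator (space N) x \<partial>N)"
        unfolding \<nu>_def space_density by (rule emeasure_density) auto
      also have "\<dots> = (\<integral>\<^sup>+x. ennreal c * (ennreal (p x) + ennreal (q x)) \<partial>N)"
      proof (intro nn_integral_cong)
        fix x assume "x \<in> space N"
        then show "ennreal (c * (p x + q x)) * indicator (space N) x = ennreal c * (ennreal (p x) + ennreal (q x))"
          using nn c by (simp add: ennreal_mult' ennreal_plus)
      qed
      also have "\<dots> = ennreal c * (1 + 1)"
        by (simp add: nn_integral_cmult nn_integral_add int)
      also have "\<dots> = ennreal (c + c)"
        using c(1) by (simp only: distrib_left mult_1_right ennreal_plus less_imp_le)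
      also have "\<dots> = 1" by (simp only: c(2) ennreal_1)
      finally show "emeasure \<nu> (space \<nu>) = 1" .
    qed
    show "d p \<in> borel_measurable \<nu>" "d q \<in> borel_measurable \<nu>"
      using d_meas[OF assms(3)] d_meas[OF assms(4)] by (simp_all add: \<nu>_def)
    show "density \<nu> (\<lambda>x. ennreal (d p x)) = density N (\<lambda>x. ennreal (p x))"
      "density \<nu> (\<lambda>x. ennreal (d q x)) = density N (\<lambda>x. ennreal (q x))"
      using nn by (auto intro!: d)
  qed (use nn c in \<open>auto simp: \<nu>_def d_def\<close>)
qed

theorem theorem1:
  fixes M :: "'w measure" and N :: "'x measure" and K :: nat and \<theta> \<alpha> :: real
    and \<tau> :: "nat \<Rightarrow> 'w \<Rightarrow> nat" and X :: "nat \<Rightarrow> nat \<Rightarrow> 'w \<Rightarrow> 'x"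
    and p q :: "'x \<Rightarrow> real" and Sstar :: "nat \<Rightarrow> 'w \<Rightarrow> nat set"
  assumes "prob_space M" and "K \<ge> 1"
    and "0 < \<theta>" and "\<theta> < 1" and "0 < \<alpha>" and "\<alpha> \<le> 1"
    and "\<forall>k\<in>{1..K}. \<tau> k \<in> measurable M (count_space UNIV)"
    and "\<forall>k\<in>{1..K}. \<forall>t\<ge>1. X k t \<in> measurable M N"
    and "\<forall>x. 0 \<le> p x" and "\<forall>x. 0 \<le> q x"
    and "p \<in> borel_measurable N" and "q \<in> borel_measurable N"
    and "(\<integral>\<^sup>+x. ennreal (p x) \<partial>N) = 1" and "(\<integral>\<^sup>+x. ennreal (q x) \<partial>N) = 1"
    and "\<forall>(m::nat \<Rightarrow> nat) (J::(nat \<times> nat) set) (B::nat \<times> nat \<Rightarrow> 'x set).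
           finite J \<longrightarrow> J \<subseteq> {1..K} \<times> {1..} \<longrightarrow> (\<forall>j\<in>J. B j \<in> sets N) \<longrightarrow>
           measure M {\<omega> \<in> space M. (\<forall>k\<in>{1..K}. \<tau> k \<omega> = m k) \<and>
                                     (\<forall>(k, t)\<in>J. X k t \<omega> \<in> B (k, t))}
           = (\<Prod>k\<in>{1..K}. \<theta> * (1 - \<theta>) ^ m k) *
             (\<Prod>(k, t)\<in>J. measure (density N (\<lambda>x. ennreal (if t \<le> m k then p x else q x))) (B (k, t)))"
    and "is_Tstar M N K X \<tau> \<alpha> Sstar"
  shows "Sstar \<in> T_alpha M N K X \<tau> \<alpha> \<and>
         (\<forall>t\<ge>1. (\<integral>\<omega>. U Sstar t \<omega> \<partial>M) = (SUP S\<in>T_alpha M N K X \<tau> \<alpha>. (\<integral>\<omega>. U S t \<omega> \<partial>M)))"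
proof -
  obtain \<nu> p' q' where \<nu>: "prob_space \<nu>" and sets: "sets \<nu> = sets N"
    and nn: "\<And>x. 0 \<le> p' x" "\<And>x. 0 \<le> q' x"
    and meas: "p' \<in> borel_measurable \<nu>" "q' \<in> borel_measurable \<nu>"
    and dens: "density \<nu> (\<lambda>x. ennreal (p' x)) = density N (\<lambda>x. ennreal (p x))"
      "density \<nu> (\<lambda>x. ennreal (q' x)) = density N (\<lambda>x. ennreal (q x))"
    using dominating_prob_space[of p q N] assms(9-14) by metis
  have mass: "(\<integral>\<^sup>+x. ennreal (r' x) \<partial>\<nu>) = (\<integral>\<^sup>+x. ennreal (r x) \<partial>N)"
    if "density \<nu> (\<lambda>x. ennreal (r' x)) = density N (\<lambda>x. ennreal (r x))"
      and [measurable]: "r' \<in> borel_measurable \<nu>" "r \<in> borel_measurable N" for r r' :: "'x \<Rightarrow> real"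
  proof -
    have "(\<integral>\<^sup>+x. 1 \<partial>density \<nu> (\<lambda>x. ennreal (r' x))) = (\<integral>\<^sup>+x. 1 \<partial>density N (\<lambda>x. ennreal (r x)))"
      unfolding that(1) ..
    then show ?thesis by (subst (asm) (1 2) nn_integral_density) auto
  qed
  interpret change_model \<nu> p' q' \<theta> M K \<tau> X
  proof (intro change_model.intro shift_kernel.intro \<nu> assms(1) shift_kernel_axioms.intro change_model_axioms.intro nn meas assms(3,4))
    show "(\<integral>\<^sup>+x. ennreal (p' x) \<partial>\<nu>) = 1" "(\<integral>\<^sup>+x. ennreal (q' x) \<partial>\<nu>) = 1"
      using mass[OF dens(1) meas(1) assms(11)] mass[OF dens(2) meas(2) assms(12)] assms(13,14) by simp_all
    show "\<tau> k \<in> measurable M (count_space UNIV)" if "k \<in> {1..K}" for k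
      using assms(7) that by blast
    show "X k t \<in> measurable M \<nu>" if "k \<in> {1..K}" "1 \<le> t" for k t
      using assms(8) that measurable_cong_sets[OF refl sets] by blast
    fix m :: "nat \<Rightarrow> nat" and J :: "(nat \<times> nat) set" and B :: "nat \<times> nat \<Rightarrow> 'x set"
    assume "finite J" "J \<subseteq> {1..K} \<times> {1..}" "\<And>j. j \<in> J \<Longrightarrow> B j \<in> sets \<nu>"
    moreover have "density N (\<lambda>x. ennreal (if t \<le> m k then p x else q x)) = density \<nu> (\<lambda>x. ennreal (if t \<le> m k then p' x else q' x))" for t k
      using dens by (cases "t \<le> m k") simp_all
    ultimately show "measure M {\<omega> \<in> space M. (\<forall>k\<in>{1..K}. \<tau> k \<omega> = m k) \<and> (\<forall>(k, t)\<in>J. X k t \<omega> \<in> B (k, t))}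
           = (\<Prod>k\<in>{1..K}. \<theta> * (1 - \<theta>) ^ m k) *
             (\<Prod>(k, t)\<in>J. measure (density \<nu> (\<lambda>x. ennreal (if t \<le> m k then p' x else q' x))) (B (k, t)))"
      using assms(15)[rule_format, of J B m] sets by simp
  qed
  \<comment> \<open>The base measure enters these definitions only through its sigma-algebra, so
    \<open>N\<close> and \<nu> give the same procedures, posteriors and error rates.\<close>
  have filt: "obs_filt M N X = obs_filt M \<nu> X"
    by (intro ext obs_filt_cong_sets sets[symmetric])
  have post: "posterior M N X = posterior M \<nu> X"
    unfolding posterior_def filt ..
  have T: "T_alpha M N K X \<tau> \<alpha> = T_alpha M \<nu> K X \<tau> \<alpha>"
    unfolding T_alpha_def is_procedure_def LFNR_next_def filt ..
  have star: "is_Tstar M \<nu> K X \<tau> \<alpha> Sstar"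
    using assms(16) unfolding is_Tstar_def post .
  have \<alpha>: "0 \<le> \<alpha>" using assms(5) by simp
  \<comment> \<open>\<open>Sstar\<close> belongs to the class and is maximal in it, so the supremum
    is a maximum, and boundedness of the set comes with it.\<close>
  show ?thesis
    unfolding T
    using is_Tstar_optimal[OF star \<alpha>]
    by (auto intro!: cSup_eq_maximum[symmetric])
qed

end
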